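(* Let $(M,g)$ be an $m$-dimensional Riemannian manifold and $\Omega\subseteq M$ a simply connected open set. Let $\boldsymbol V$ be a $C^1$ vector field on $\Omega$, written in local coordinates as $\boldsymbol V=\sum_{k=1}^m V_k\,\partial_{x_k}$. Then the system $$\nabla_g u=\boldsymbol V\quad\text{in }\Omega$$ is solvable in $C^2(\Omega)$ if and only if $$\partial_{x_i}\tilde V_j=\partial_{x_j}\tilde V_i\quad\text{in }\Omega,\ \text{for every } i,j=1,\dots,m,$$ where $\tilde V_j=\sum_{k=1}^m g_{jk}V_k$. Moreover, if $x_0\in\Omega$ is fixed and $\partial_{x_i}\tilde V_j=\partial_{x_j}\tilde V_i$ holds in $\Omega$ for every $i,j=1,\dots,m$, the solution $u:\Omega\to\mathbb R$ of $\nabla_gu=\boldsymbol V$ can be obtained by $$u(x)=c_0+\int_0^1\langle \boldsymbol V(\gamma(t)),\dot\gamma(t)\rangle_g\,dt,\qquad x\in\Omega,$$ where $c_0=u(x_0)\in\mathbb R$ and $\gamma:[0,1]\to\Omega$ is any curve joining $x_0$ with $x$.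
   Context: $(g_{ij})$ are the components of the Riemannian metric $g=\langle\cdot,\cdot\rangle_g$ in local coordinates $(x_i)_{i=1,\dots,m}$, and $(g^{ij})=(g_{ij})^{-1}$. For a $C^1$ function $u$, the gradient $\nabla_gu$ is defined by $du(x)(v)=\langle\nabla_gu(x),v\rangle_g$ for all $v\in T_xM$; its local components are $\sum_k g^{ik}\partial_{x_k}u$. The relations $\partial_{x_i}\tilde V_j=\partial_{x_j}\tilde V_i$ are expressed in local coordinates. Curves are smooth paths. *)

theory Defs
  imports "HOL-Analysis.Analysis"
begin

section \<open>Functions of class \<open>C\<^sup>k\<close> on Euclidean sets\<close>

text \<open>
  Derivatives are taken within \<open>S\<close>, so that the definition covers both open sets and relatively
  open subsets of \<open>{0..1}\<close> (one-sided derivatives at the end points). It is meant only for sets on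
  which derivatives are unique, which is the case for all sets it is applied to below.
\<close>

primrec Ck_on :: "nat \<Rightarrow> 'e::euclidean_space set \<Rightarrow> ('e \<Rightarrow> 'b::real_normed_vector) \<Rightarrow> bool" where
  "Ck_on 0 S f \<longleftrightarrow> continuous_on S f"
| "Ck_on (Suc k) S f \<longleftrightarrow>
     (\<forall>x\<in>S. f differentiable (at x within S)) \<and>
     (\<forall>v. Ck_on k S (\<lambda>x. frechet_derivative f (at x within S) v))"

definition smooth_on :: "'e::euclidean_space set \<Rightarrow> ('e \<Rightarrow> 'b::real_normed_vector) \<Rightarrow> bool" where
  "smooth_on S f \<longleftrightarrow> (\<forall>k. Ck_on k S f)"


section \<open>Smooth manifolds\<close>

text \<open>
  The manifold is the whole topological space \<open>'a\<close>; its dimension is \<open>CARD('m)\<close>. A chart is given by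
  its domain and its coordinate map, whose values off the domain are irrelevant. The atlas is not
  required to be maximal.
\<close>

type_synonym ('a, 'm) chart = "'a set \<times> ('a \<Rightarrow> real ^ 'm)"

definition is_chart :: "('a::topological_space, 'm::finite) chart \<Rightarrow> bool" where
  "is_chart c \<longleftrightarrow> open (fst c) \<and> open (snd c ` fst c) \<and>
     (\<exists>\<psi>. homeomorphism (fst c) (snd c ` fst c) (snd c) \<psi>)"

definition chart_inv :: "('a, 'm::finite) chart \<Rightarrow> real ^ 'm \<Rightarrow> 'a" where
  "chart_inv c = inv_into (fst c) (snd c)"

definition smooth_atlas :: "('a::topological_space, 'm::finite) chart set \<Rightarrow> bool" where
  "smooth_atlas A \<longleftrightarrow> (\<forall>c\<in>A. is_chart c) \<and> (\<Union>c\<in>A. fst c) = UNIV \<and>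
     (\<forall>c\<in>A. \<forall>d\<in>A. smooth_on (snd c ` (fst c \<inter> fst d)) (snd d \<circ> chart_inv c))"

definition Ck_function ::
    "('a, 'm::finite) chart set \<Rightarrow> nat \<Rightarrow> 'a set \<Rightarrow> ('a \<Rightarrow> real) \<Rightarrow> bool" where
  "Ck_function A k W u \<longleftrightarrow> (\<forall>c\<in>A. Ck_on k (snd c ` (fst c \<inter> W)) (u \<circ> chart_inv c))"

definition differentiable_at ::
    "('a, 'm::finite) chart set \<Rightarrow> ('a \<Rightarrow> real) \<Rightarrow> 'a \<Rightarrow> bool" where
  "differentiable_at A u p \<longleftrightarrow>
     (\<forall>c\<in>A. p \<in> fst c \<longrightarrow> (u \<circ> chart_inv c) differentiable (at (snd c p)))"

definition coord_partial :: "('a, 'm::finite) chart \<Rightarrow> 'm \<Rightarrow> ('a \<Rightarrow> real) \<Rightarrow> 'a \<Rightarrow> real" where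
  "coord_partial c i u p = frechet_derivative (u \<circ> chart_inv c) (at (snd c p)) (axis i 1)"


section \<open>Tangent vectors\<close>

text \<open>
  A tangent vector at \<open>p\<close> is a directional derivative operator acting on the functions that are
  differentiable at \<open>p\<close>. To make these operators extensional, they are set to \<open>0\<close> on all other
  functions. Linear operations on tangent vectors are pointwise.
\<close>

type_synonym 'a tangent = "('a \<Rightarrow> real) \<Rightarrow> real"

text \<open>The coordinate vector \<open>\<partial>\<^sub>x\<^sub>i\<close> at \<open>p\<close>.\<close>

definition coord_vector ::
    "('a, 'm::finite) chart set \<Rightarrow> ('a, 'm) chart \<Rightarrow> 'm \<Rightarrow> 'a \<Rightarrow> 'a tangent" where
  "coord_vector A c i p = (\<lambda>u. if differentiable_at A u p then coord_partial c i u p else 0)"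

definition coord_combination ::
    "('a, 'm::finite) chart set \<Rightarrow> ('a, 'm) chart \<Rightarrow> 'a \<Rightarrow> real ^ 'm \<Rightarrow> 'a tangent" where
  "coord_combination A c p a = (\<lambda>u. \<Sum>i\<in>UNIV. a $ i * coord_vector A c i p u)"

text \<open>By the chain rule, the span below does not depend on the chart around \<open>p\<close>.\<close>

definition tangent_space :: "('a, 'm::finite) chart set \<Rightarrow> 'a \<Rightarrow> 'a tangent set" where
  "tangent_space A p = {v. \<exists>c\<in>A. p \<in> fst c \<and> (\<exists>a. v = coord_combination A c p a)}"

definition components ::
    "('a, 'm::finite) chart set \<Rightarrow> ('a, 'm) chart \<Rightarrow> 'a \<Rightarrow> 'a tangent \<Rightarrow> real ^ 'm" where
  "components A c p v = (THE a. v = coord_combination A c p a)"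

text \<open>The differential \<open>du(p)(v)\<close>; as \<open>v\<close> is a directional derivative operator, it is \<open>v u\<close>.\<close>

definition differential :: "('a \<Rightarrow> real) \<Rightarrow> 'a \<Rightarrow> 'a tangent \<Rightarrow> real" where
  "differential u p v = v u"

definition Ck_vector_field ::
    "('a, 'm::finite) chart set \<Rightarrow> nat \<Rightarrow> 'a set \<Rightarrow> ('a \<Rightarrow> 'a tangent) \<Rightarrow> bool" where
  "Ck_vector_field A k W V \<longleftrightarrow>
     (\<forall>p\<in>W. V p \<in> tangent_space A p) \<and>
     (\<forall>c\<in>A. \<forall>i. Ck_on k (snd c ` (fst c \<inter> W))
        ((\<lambda>p. components A c p (V p) $ i) \<circ> chart_inv c))"


section \<open>Riemannian metrics\<close>

type_synonym 'a metric_tensor = "'a \<Rightarrow> 'a tangent \<Rightarrow> 'a tangent \<Rightarrow> real"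

definition inner_product_on :: "'a tangent set \<Rightarrow> ('a tangent \<Rightarrow> 'a tangent \<Rightarrow> real) \<Rightarrow> bool" where
  "inner_product_on T b \<longleftrightarrow>
     (\<forall>v\<in>T. \<forall>w\<in>T. b v w = b w v) \<and>
     (\<forall>v\<in>T. \<forall>v'\<in>T. \<forall>w\<in>T. \<forall>r s. b (\<lambda>u. r * v u + s * v' u) w = r * b v w + s * b v' w) \<and>
     (\<forall>v\<in>T. v \<noteq> (\<lambda>u. 0) \<longrightarrow> b v v > 0)"

text \<open>The components \<open>g\<^sub>i\<^sub>j\<close> of the metric in a chart.\<close>

definition metric_coeff ::
    "('a, 'm::finite) chart set \<Rightarrow> 'a metric_tensor \<Rightarrow> ('a, 'm) chart \<Rightarrow> 'm \<Rightarrow> 'm \<Rightarrow> 'a \<Rightarrow> real" where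
  "metric_coeff A g c i j p = g p (coord_vector A c i p) (coord_vector A c j p)"

definition riemannian_manifold ::
    "('a::{t2_space, second_countable_topology}, 'm::finite) chart set \<Rightarrow> 'a metric_tensor \<Rightarrow> bool" where
  "riemannian_manifold A g \<longleftrightarrow>
     smooth_atlas A \<and>
     (\<forall>p. inner_product_on (tangent_space A p) (g p)) \<and>
     (\<forall>c\<in>A. \<forall>i j. smooth_on (snd c ` fst c) (metric_coeff A g c i j \<circ> chart_inv c))"

definition gradient ::
    "('a, 'm::finite) chart set \<Rightarrow> 'a metric_tensor \<Rightarrow> ('a \<Rightarrow> real) \<Rightarrow> 'a \<Rightarrow> 'a tangent" where
  "gradient A g u p =
     (THE w. w \<in> tangent_space A p \<and> (\<forall>v\<in>tangent_space A p. differential u p v = g p w v))"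

text \<open>The functions \<open>\<Sum>\<^sub>k g\<^sub>j\<^sub>k V\<^sub>k\<close>.\<close>

definition lowered ::
    "('a, 'm::finite) chart set \<Rightarrow> 'a metric_tensor \<Rightarrow> ('a \<Rightarrow> 'a tangent) \<Rightarrow> ('a, 'm) chart \<Rightarrow>
      'm \<Rightarrow> 'a \<Rightarrow> real" where
  "lowered A g V c j p = (\<Sum>k\<in>UNIV. metric_coeff A g c j k p * components A c p (V p) $ k)"

definition integrability_condition ::
    "('a, 'm::finite) chart set \<Rightarrow> 'a metric_tensor \<Rightarrow> 'a set \<Rightarrow> ('a \<Rightarrow> 'a tangent) \<Rightarrow> bool" where
  "integrability_condition A g W V \<longleftrightarrow>
     (\<forall>c\<in>A. \<forall>p\<in>fst c \<inter> W. \<forall>i j.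
        coord_partial c i (lowered A g V c j) p = coord_partial c j (lowered A g V c i) p)"

definition C2_solution ::
    "('a, 'm::finite) chart set \<Rightarrow> 'a metric_tensor \<Rightarrow> 'a set \<Rightarrow> ('a \<Rightarrow> 'a tangent) \<Rightarrow>
      ('a \<Rightarrow> real) \<Rightarrow> bool" where
  "C2_solution A g W V u \<longleftrightarrow> Ck_function A 2 W u \<and> (\<forall>x\<in>W. gradient A g u x = V x)"


section \<open>Smooth curves and line integrals\<close>

definition smooth_curve :: "('a::topological_space, 'm::finite) chart set \<Rightarrow> (real \<Rightarrow> 'a) \<Rightarrow> bool" where
  "smooth_curve A \<gamma> \<longleftrightarrow> path \<gamma> \<and> (\<forall>c\<in>A. smooth_on {t\<in>{0..1}. \<gamma> t \<in> fst c} (snd c \<circ> \<gamma>))"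

definition curve_joining ::
    "('a::topological_space, 'm::finite) chart set \<Rightarrow> 'a set \<Rightarrow> 'a \<Rightarrow> 'a \<Rightarrow> (real \<Rightarrow> 'a) \<Rightarrow> bool" where
  "curve_joining A W x y \<gamma> \<longleftrightarrow>
     smooth_curve A \<gamma> \<and> path_image \<gamma> \<subseteq> W \<and> pathstart \<gamma> = x \<and> pathfinish \<gamma> = y"

definition velocity :: "('a, 'm::finite) chart set \<Rightarrow> (real \<Rightarrow> 'a) \<Rightarrow> real \<Rightarrow> 'a tangent" where
  "velocity A \<gamma> t =
     (\<lambda>u. if differentiable_at A u (\<gamma> t)
          then vector_derivative (u \<circ> \<gamma>) (at t within {0..1}) else 0)"

definition line_integrand ::
    "('a, 'm::finite) chart set \<Rightarrow> 'a metric_tensor \<Rightarrow> ('a \<Rightarrow> 'a tangent) \<Rightarrow> (real \<Rightarrow> 'a) \<Rightarrow>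
      real \<Rightarrow> real" where
  "line_integrand A g V \<gamma> t = g (\<gamma> t) (V (\<gamma> t)) (velocity A \<gamma> t)"

end

theory Submission
  imports Defs
begin

text \<open>
  A \<open>C\<^sup>2\<close> function \<open>u\<close> solves the equation iff in every chart the differential of \<open>u\<close> is the
  1-form with coefficients \<open>\<Sum>\<^sub>k g\<^sub>j\<^sub>k V\<^sub>k\<close>, so solvability forces these coefficients to satisfy the symmetry
  of second derivatives. Conversely, the symmetry gives primitives on chart balls by the Poincare
  lemma. Any two local primitives differ by a locally constant function, so they can be continued
  along paths and along homotopies; on a simply connected set the increment of a continuation over a
  loop vanishes, and the local primitives glue to a global one. The line integral formula is then the
  fundamental theorem of calculus along the curve. Smooth curves exist because
  smooth curves that are stationary at their ends can be concatenated.
\<close>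

section \<open>Calculus of \<open>C\<^sup>k\<close> functions\<close>

text \<open>Simple connectedness supplies homotopies that are merely continuous, so the intermediate
  loops carry no line integral, and invariance of the integral under homotopy cannot be argued
  directly. Continuation replaces it: a function on the parameter space is compared with local
  primitives only through increments, so nothing is differentiated along a path. The global solution
  is the total increment along continuous paths; smooth curves enter only afterwards, for the
  formula. The formula itself is never differentiated: a function given by it is compared with a
  solution already known to exist. Two features of the definitions shape the rest. Derivatives are
  taken within sets that may contain end points of an interval, so their uniqueness has to be
  secured. Tangent vectors vanish on functions that are not differentiable, and the gradient is a
  definite description, so differentiability and the existence of a representing vector come before
  any use of the gradient equation in coordinates.\<close>

definition axis_accumulating :: "'e::euclidean_space set \<Rightarrow> bool" where
  "axis_accumulating S \<longleftrightarrow>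
     (\<forall>x\<in>S. \<forall>i\<in>Basis. \<forall>e>0. \<exists>d. 0 < \<bar>d\<bar> \<and> \<bar>d\<bar> < e \<and> x + d *\<^sub>R i \<in> S)"

text \<open>\<open>frechet_derivative\<close> selects some derivative, and within a thin set there
  may be several. Approach along every axis, from one side at least, makes it unique; open sets and
  relatively open parts of \<open>{0..1}\<close> both allow this.\<close>

lemma has_derivative_unique_accumulating:
  assumes "axis_accumulating S" "x \<in> S"
    "(f has_derivative f') (at x within S)" "(f has_derivative f'') (at x within S)"
  shows "f' = f''"
  using assms by (intro frechet_derivative_unique_within[OF assms(3,4)]) (auto simp: axis_accumulating_def)

lemma frechet_derivative_accumulating:
  assumes "axis_accumulating S" "x \<in> S" "(f has_derivative f') (at x within S)"
  shows "frechet_derivative f (at x within S) = f'"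
  using assms frechet_derivative_works has_derivative_unique_accumulating
  by (metis differentiable_def)

lemma axis_accumulating_open:
  assumes "open S" shows "axis_accumulating S"
  unfolding axis_accumulating_def
proof (intro ballI allI impI)
  fix x i :: 'a and e :: real
  assume "x \<in> S" "i \<in> Basis" "e > 0"
  from assms \<open>x \<in> S\<close> obtain r where r: "r > 0" "ball x r \<subseteq> S"
    by (auto simp: open_contains_ball)
  define d where "d = min r e / 2"
  have d: "d > 0" "d < r" "d < e" using r(1) \<open>e > 0\<close> by (auto simp: d_def min_def)
  have "x + d *\<^sub>R i \<in> ball x r" using d \<open>i \<in> Basis\<close> by (simp add: dist_norm)
  then show "\<exists>d. 0 < \<bar>d\<bar> \<and> \<bar>d\<bar> < e \<and> x + d *\<^sub>R i \<in> S"
    using d r by (intro exI[of _ d]) auto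
qed

lemma axis_accumulating_UNIV: "axis_accumulating UNIV"
  by (simp add: axis_accumulating_open)

lemma axis_accumulating_Int_open:
  assumes "axis_accumulating S" "open N"
  shows "axis_accumulating (S \<inter> N)"
  unfolding axis_accumulating_def
proof (intro ballI allI impI)
  fix x i :: 'a and e :: real
  assume x: "x \<in> S \<inter> N" and i: "i \<in> Basis" and "e > 0"
  from assms(2) x obtain r where r: "r > 0" "ball x r \<subseteq> N"
    by (auto simp: open_contains_ball)
  have "min r e > 0" using r \<open>e > 0\<close> by auto
  then obtain d where d: "0 < \<bar>d\<bar>" "\<bar>d\<bar> < min r e" "x + d *\<^sub>R i \<in> S"
    using assms(1) x i unfolding axis_accumulating_def by blast
  have "x + d *\<^sub>R i \<in> ball x r" using d i by (simp add: dist_norm)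
  then show "\<exists>d. 0 < \<bar>d\<bar> \<and> \<bar>d\<bar> < e \<and> x + d *\<^sub>R i \<in> S \<inter> N"
    using d r by (intro exI[of _ d]) auto
qed

lemma axis_accumulating_unit_interval: "axis_accumulating {0..1::real}"
  unfolding axis_accumulating_def
proof (intro ballI allI impI)
  fix x i e :: real
  assume x: "x \<in> {0..1}" and i: "i \<in> Basis" and e: "e > 0"
  \<comment> \<open>Points of the left half move right and all others move left, by at most 1/2, so
    the interval is not left.\<close>
  define d where "d = (if x < 1/2 then min e 1 / 2 else - (min e 1 / 2))"
  have "0 < \<bar>d\<bar> \<and> \<bar>d\<bar> < e \<and> x + d *\<^sub>R i \<in> {0..1}"
    using x i e by (auto simp: d_def min_def)
  then show "\<exists>d. 0 < \<bar>d\<bar> \<and> \<bar>d\<bar> < e \<and> x + d *\<^sub>R i \<in> {0..1}" by blast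
qed

text \<open>\<open>frechet_derivative\<close> is a choice from the set of derivatives, and both
  functions have the same set, so the choices agree even where that set is empty.\<close>

lemma frechet_derivative_cong:
  assumes "x \<in> S" "\<And>y. y \<in> S \<Longrightarrow> f y = g y"
  shows "frechet_derivative f (at x within S) = frechet_derivative g (at x within S)"
proof -
  have "(f has_derivative f') (at x within S) = (g has_derivative f') (at x within S)" for f'
    using assms by (metis has_derivative_transform)
  then show ?thesis by (simp add: frechet_derivative_def)
qed

lemma Ck_on_cong:
  assumes "\<And>x. x \<in> S \<Longrightarrow> f x = g x"
  shows "Ck_on k S f \<longleftrightarrow> Ck_on k S g"
  using assms
proof (induction k arbitrary: f g)
  case 0
  then show ?case by (simp cong: continuous_on_cong)
next
  case (Suc k)
  have "f differentiable (at x within S) \<longleftrightarrow> g differentiable (at x within S)" if "x \<in> S" for x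
    using Suc.prems that unfolding differentiable_def by (metis has_derivative_transform)
  moreover have "Ck_on k S (\<lambda>x. frechet_derivative f (at x within S) v) \<longleftrightarrow>
      Ck_on k S (\<lambda>x. frechet_derivative g (at x within S) v)" for v
    by (rule Suc.IH) (simp add: frechet_derivative_cong[OF _ Suc.prems])
  ultimately show ?case by auto
qed

text \<open>By uniqueness an explicitly known derivative may stand for the selected one in the
  recursion of \<open>Ck_on\<close>.\<close>

lemma Ck_on_SucI:
  assumes "axis_accumulating S" "\<And>x. x \<in> S \<Longrightarrow> (f has_derivative f' x) (at x within S)"
    "\<And>v. Ck_on k S (\<lambda>x. f' x v)"
  shows "Ck_on (Suc k) S f"
proof -
  have "Ck_on k S (\<lambda>x. frechet_derivative f (at x within S) v)" for v
    using assms(3)[of v] frechet_derivative_accumulating[OF assms(1) _ assms(2)]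
    by (subst Ck_on_cong) auto
  then show ?thesis using assms(2) by (auto simp: differentiable_def)
qed

lemma Ck_on_SucD:
  assumes "Ck_on (Suc k) S f"
  shows "\<And>x. x \<in> S \<Longrightarrow> (f has_derivative frechet_derivative f (at x within S)) (at x within S)"
    and "\<And>v. Ck_on k S (\<lambda>x. frechet_derivative f (at x within S) v)"
  using assms by (auto simp: frechet_derivative_works)

lemma Ck_on_imp_continuous_on: "Ck_on k S f \<Longrightarrow> continuous_on S f"
  by (cases k) (auto simp: continuous_on_eq_continuous_within intro: differentiable_imp_continuous_within)

lemma Ck_on_Suc_imp: "Ck_on (Suc k) S f \<Longrightarrow> Ck_on k S f"
proof (induction k arbitrary: f)
  case 0
  then show ?case using Ck_on_imp_continuous_on[OF 0] by simp
next
  case (Suc k)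
  then show ?case by (metis Ck_on.simps(2))
qed

text \<open>A derivative within the larger set is also one within \<open>T\<close>, and there it is
  the only one.\<close>

lemma Ck_on_subset:
  assumes "Ck_on k S f" "T \<subseteq> S" "axis_accumulating T"
  shows "Ck_on k T f"
  using assms(1)
proof (induction k arbitrary: f)
  case 0
  then show ?case using assms(2) continuous_on_subset by auto
next
  case (Suc k)
  show ?case
  proof (rule Ck_on_SucI[OF assms(3)])
    show "(f has_derivative frechet_derivative f (at x within S)) (at x within T)" if "x \<in> T" for x
      using Ck_on_SucD(1)[OF Suc.prems] that assms(2) by (meson has_derivative_subset subsetD)
    show "Ck_on k T (\<lambda>x. frechet_derivative f (at x within S) v)" for v
      using Suc.IH Ck_on_SucD(2)[OF Suc.prems] by blast
  qed
qed

text \<open>At points of an open \<open>N\<close>, the filters \<open>at x within S\<close> and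
  \<open>at x within S \<inter> N\<close> coincide, hence so do the derivatives.\<close>

lemma Ck_on_local:
  assumes "\<And>x. x \<in> S \<Longrightarrow> \<exists>N. open N \<and> x \<in> N \<and> Ck_on k (S \<inter> N) f"
  shows "Ck_on k S f"
  using assms
proof (induction k arbitrary: f)
  case 0
  have "continuous (at x within S) f" if "x \<in> S" for x
  proof -
    obtain N where N: "open N" "x \<in> N" "continuous_on (S \<inter> N) f" using 0 \<open>x \<in> S\<close> by auto
    have "at x within S = at x within S \<inter> N"
      using N by (intro at_within_nhd[of _ N]) auto
    with N that show ?thesis by (simp add: continuous_on_eq_continuous_within)
  qed
  then show ?case by (simp add: continuous_on_eq_continuous_within)
next
  case (Suc k)
  have at: "at y within S = at y within S \<inter> N" if "open N" "y \<in> N" for N y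
    using that by (intro at_within_nhd[of _ N]) auto
  have "Ck_on k S (\<lambda>x. frechet_derivative f (at x within S) v)" for v
  proof (rule Suc.IH)
    fix x assume "x \<in> S"
    then obtain N where N: "open N" "x \<in> N" "Ck_on (Suc k) (S \<inter> N) f" using Suc.prems by blast
    have "Ck_on k (S \<inter> N) (\<lambda>x. frechet_derivative f (at x within S \<inter> N) v)"
      using N(3) by simp
    then have "Ck_on k (S \<inter> N) (\<lambda>x. frechet_derivative f (at x within S) v)"
      by (subst Ck_on_cong) (auto simp: at[OF N(1)])
    with N show "\<exists>N. open N \<and> x \<in> N \<and> Ck_on k (S \<inter> N) (\<lambda>x. frechet_derivative f (at x within S) v)"
      by blast
  qed
  moreover have "f differentiable (at x within S)" if "x \<in> S" for x
    using Suc.prems[OF that] at that by fastforce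
  ultimately show ?case by simp
qed

lemma Ck_on_const:
  assumes "axis_accumulating S" shows "Ck_on k S (\<lambda>x. c)"
proof (induction k arbitrary: c)
  case (Suc k)
  show ?case by (rule Ck_on_SucI[OF assms, where f' = "\<lambda>_ _. 0"]) (auto simp: Suc.IH)
qed auto

lemma Ck_on_bounded_linear:
  assumes "axis_accumulating S" "bounded_linear L" "Ck_on k S f"
  shows "Ck_on k S (\<lambda>x. L (f x))"
  using assms(3)
proof (induction k arbitrary: f)
  case 0
  then show ?case using assms(2) by (auto intro: bounded_linear.continuous_on)
next
  case (Suc k)
  show ?case
    using bounded_linear.has_derivative[OF assms(2) Ck_on_SucD(1)[OF Suc.prems]]
      Suc.IH[OF Ck_on_SucD(2)[OF Suc.prems]]
    by (intro Ck_on_SucI[OF assms(1), where f' = "\<lambda>x v. L (frechet_derivative f (at x within S) v)"]) auto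
qed

lemma Ck_on_add:
  assumes "axis_accumulating S" "Ck_on k S f" "Ck_on k S g"
  shows "Ck_on k S (\<lambda>x. f x + g x)"
  using assms(2,3)
proof (induction k arbitrary: f g)
  case 0
  then show ?case by (auto intro: continuous_intros)
next
  case (Suc k)
  show ?case
    using has_derivative_add[OF Ck_on_SucD(1)[OF Suc.prems(1)] Ck_on_SucD(1)[OF Suc.prems(2)]]
      Suc.IH[OF Ck_on_SucD(2)[OF Suc.prems(1)] Ck_on_SucD(2)[OF Suc.prems(2)]]
    by (intro Ck_on_SucI[OF assms(1)]) auto
qed

lemma Ck_on_sum:
  assumes "axis_accumulating S" "\<And>i. i \<in> I \<Longrightarrow> Ck_on k S (f i)"
  shows "Ck_on k S (\<lambda>x. \<Sum>i\<in>I. f i x)"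
  using assms(2) by (induction I rule: infinite_finite_induct) (auto intro: Ck_on_add Ck_on_const assms(1))

lemma Ck_on_scaleR:
  fixes f :: "_ \<Rightarrow> real"
  assumes "axis_accumulating S" "Ck_on k S f" "Ck_on k S g"
  shows "Ck_on k S (\<lambda>x. f x *\<^sub>R g x)"
  using assms(2,3)
proof (induction k arbitrary: f g)
  case 0
  then show ?case by (auto intro: continuous_intros)
next
  case (Suc k)
  show ?case
  proof (rule Ck_on_SucI[OF assms(1) has_derivative_scaleR[OF Ck_on_SucD(1)[OF Suc.prems(1)] Ck_on_SucD(1)[OF Suc.prems(2)]]])
    show "Ck_on k S (\<lambda>x. f x *\<^sub>R frechet_derivative g (at x within S) v
       + frechet_derivative f (at x within S) v *\<^sub>R g x)" for v
      by (intro Ck_on_add assms(1) Suc.IH Ck_on_SucD(2) Suc.prems Ck_on_Suc_imp)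
  qed auto
qed

lemma Ck_on_compose:
  fixes h :: "'d::euclidean_space \<Rightarrow> 'e::euclidean_space" and f :: "'e \<Rightarrow> 'b::real_normed_vector"
  assumes "axis_accumulating S" "Ck_on k S h" "Ck_on k T f" "h ` S \<subseteq> T"
  shows "Ck_on k S (f \<circ> h)"
  using assms(2,3)
proof (induction k arbitrary: f)
  case 0
  then show ?case using assms(4) by (auto simp del: o_apply intro!: continuous_on_compose intro: continuous_on_subset)
next
  case (Suc k)
  let ?h' = "\<lambda>x. frechet_derivative h (at x within S)"
  let ?f' = "\<lambda>y. frechet_derivative f (at y within T)"
  show ?case
  proof (rule Ck_on_SucI[OF assms(1)])
    fix x assume x: "x \<in> S"
    have "(f has_derivative ?f' (h x)) (at (h x) within h ` S)"
      using Ck_on_SucD(1)[OF Suc.prems(2)] x assms(4) by (meson has_derivative_subset image_subset_iff)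
    from diff_chain_within[OF Ck_on_SucD(1)[OF Suc.prems(1) x] this]
    show "(f \<circ> h has_derivative (\<lambda>v. ?f' (h x) (?h' x v))) (at x within S)" by (simp add: o_def)
  next
    fix v
    \<comment> \<open>The derivative depends on \<open>x\<close> through the base point and through
      the vector. Expanding the vector in the basis separates the two: each term is a scalar
      function of class \<open>k\<close> times a partial derivative of \<open>f\<close> composed
      with \<open>h\<close>, to which the induction hypothesis applies.\<close>
    have "Ck_on k S (\<lambda>x. \<Sum>b\<in>Basis. (?h' x v \<bullet> b) *\<^sub>R (((\<lambda>y. ?f' y b) \<circ> h) x))"
      by (rule Ck_on_sum[OF assms(1)], rule Ck_on_scaleR[OF assms(1)],
          rule Ck_on_bounded_linear[OF assms(1) bounded_linear_inner_left], rule Ck_on_SucD(2)[OF Suc.prems(1)],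
          rule Suc.IH, rule Ck_on_Suc_imp[OF Suc.prems(1)], rule Ck_on_SucD(2)[OF Suc.prems(2)])
    moreover have "?f' (h x) (?h' x v) = (\<Sum>b\<in>Basis. (?h' x v \<bullet> b) *\<^sub>R (((\<lambda>y. ?f' y b) \<circ> h) x))"
      if "x \<in> S" for x
    proof -
      have "linear (?f' (h x))"
        using Ck_on_SucD(1)[OF Suc.prems(2)] that assms(4) has_derivative_linear by blast
      then have "?f' (h x) (\<Sum>b\<in>Basis. (?h' x v \<bullet> b) *\<^sub>R b) = (\<Sum>b\<in>Basis. (?h' x v \<bullet> b) *\<^sub>R ?f' (h x) b)"
        by (simp add: linear_sum linear_scale)
      then show ?thesis by (simp add: euclidean_representation)
    qed
    ultimately show "Ck_on k S (\<lambda>x. ?f' (h x) (?h' x v))" by (subst Ck_on_cong)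
  qed
qed

lemma Ck_on_affine:
  fixes a :: "'e::euclidean_space"
  assumes "axis_accumulating (S::real set)"
  shows "Ck_on k S (\<lambda>t. a + t *\<^sub>R b)"
proof (cases k)
  case 0
  then show ?thesis by (auto intro!: continuous_intros)
next
  case (Suc j)
  show ?thesis unfolding Suc
    by (rule Ck_on_SucI[OF assms, where f' = "\<lambda>_ v. v *\<^sub>R b"])
      (auto intro!: derivative_eq_intros Ck_on_const assms)
qed

lemma Ck_on_vec_lambda:
  fixes f :: "'n::finite \<Rightarrow> 'e::euclidean_space \<Rightarrow> real"
  assumes "axis_accumulating S" "\<And>i. Ck_on k S (f i)"
  shows "Ck_on k S (\<lambda>x. \<chi> i. f i x)"
proof -
  have "Ck_on k S (\<lambda>x. \<Sum>i\<in>UNIV. f i x *\<^sub>R axis i (1::real))"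
    by (intro Ck_on_sum Ck_on_scaleR Ck_on_const assms)
  moreover have "(\<Sum>i\<in>UNIV. f i x *\<^sub>R axis i (1::real)) = (\<chi> i. f i x)" for x
    by (simp add: vec_eq_iff axis_def if_distrib cong: if_cong)
  ultimately show ?thesis by (simp only:)
qed

section \<open>A smooth step function\<close>

text \<open>With \<open>q\<close> and \<open>n\<close> varying, these functions form a class closed under differentiation.\<close>

definition bump :: "real poly \<Rightarrow> nat \<Rightarrow> real \<Rightarrow> real" where
  "bump q n t = (if 0 < t \<and> t < 1
     then poly q t / (t * (1 - t)) ^ n * exp (- (1 / (t * (1 - t)))) else 0)"

text \<open>The single term of order \<open>n + 2\<close> in the series of
  \<open>exp (1 / s)\<close> is a lower bound. Its two powers beyond \<open>n\<close> leave the
  factor \<open>s ^ 2\<close> that forces derivative 0 at the ends of the bump.\<close>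

lemma exp_inverse_bound:
  assumes "s > (0::real)"
  shows "exp (- (1 / s)) / s ^ n \<le> fact (n + 2) * s\<^sup>2"
proof -
  have "(1 / s) ^ (n + 2) / fact (n + 2) \<le> exp (1 / s)"
  proof -
    have "(\<Sum>k\<in>{n+2}. (1 / s) ^ k / fact k) \<le> (\<Sum>k. (1 / s) ^ k / fact k)"
      using assms summable_exp[of "1/s"]
      by (intro sum_le_suminf) (auto simp: field_simps)
    then show ?thesis by (simp add: exp_def field_simps scaleR_conv_of_real)
  qed
  then have "1 \<le> fact (n + 2) * s ^ (n + 2) * exp (1 / s)"
    using assms by (simp add: field_simps del: fact_Suc add_2_eq_Suc')
  then have "exp (- (1 / s)) \<le> fact (n + 2) * s ^ (n + 2)"
    using assms by (simp add: exp_minus divide_simps mult.commute del: fact_Suc add_2_eq_Suc')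
  then show ?thesis using assms by (simp add: field_simps power_add power2_eq_square del: fact_Suc add_2_eq_Suc')
qed

text \<open>The number \<open>s = x * (1 - x)\<close> is at most the distance from \<open>x\<close>
  to either end point, hence to every \<open>t\<close> outside the open interval; the polynomial is
  bounded on the unit interval by compactness.\<close>

lemma bump_bound:
  obtains C where "\<And>x t. t \<notin> {0<..<1} \<Longrightarrow> \<bar>bump q n x\<bar> \<le> C * (x - t)\<^sup>2"
proof -
  have "compact ((\<lambda>t. poly q t) ` {0..1})" by (intro compact_continuous_image continuous_intros) auto
  then obtain M where "\<forall>x\<in>(\<lambda>t. poly q t) ` {0..1}. norm x \<le> M"
    by (auto simp only: bounded_iff dest!: compact_imp_bounded)
  then have M: "\<And>t. t \<in> {0..1} \<Longrightarrow> \<bar>poly q t\<bar> \<le> M" by auto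
  have "M \<ge> 0" using M[of 0] by auto
  have "\<bar>bump q n x\<bar> \<le> M * fact (n + 2) * (x - t)\<^sup>2" if t: "t \<notin> {0<..<1}" for x t
  proof (cases "0 < x \<and> x < 1")
    case True
    define s where "s = x * (1 - x)"
    have s: "s > 0" using True by (simp add: s_def)
    have "s \<le> \<bar>x - t\<bar>"
    proof -
      have "s \<le> x" "s \<le> 1 - x"
        using True mult_left_le[of "1 - x" x] mult_left_le_one_le[of "1 - x" x] by (auto simp: s_def)
      then show ?thesis using t by auto
    qed
    then have s2: "s\<^sup>2 \<le> (x - t)\<^sup>2" using s by (simp add: abs_le_square_iff[symmetric])
    have "\<bar>bump q n x\<bar> = \<bar>poly q x\<bar> * (exp (- (1 / s)) / s ^ n)"
      using True s by (simp add: bump_def s_def[symmetric] abs_mult)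
    also have "\<dots> \<le> M * (fact (n + 2) * s\<^sup>2)"
      using True s by (intro mult_mono exp_inverse_bound M \<open>M \<ge> 0\<close>) auto
    also have "\<dots> \<le> M * (fact (n + 2) * (x - t)\<^sup>2)"
      using s2 \<open>M \<ge> 0\<close> by (intro mult_left_mono) auto
    finally show ?thesis by (simp add: mult.assoc)
  qed (use \<open>M \<ge> 0\<close> in \<open>auto simp: bump_def\<close>)
  then show ?thesis using that by blast
qed

lemma DERIV_zero_of_quadratic_bound:
  fixes f :: "real \<Rightarrow> real"
  assumes "\<And>x. \<bar>f x\<bar> \<le> C * (x - t)\<^sup>2"
  shows "(f has_real_derivative 0) (at t)"
proof -
  have "f t = 0" using assms[of t] by simp
  have "((\<lambda>h. f (t + h) / h) \<longlongrightarrow> 0) (at 0)"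
  proof (rule Lim_null_comparison)
    show "\<forall>\<^sub>F h in at 0. norm (f (t + h) / h) \<le> C * \<bar>h\<bar>"
    proof (intro eventually_at_filter[THEN iffD2] always_eventually allI impI)
      fix h :: real assume "h \<noteq> 0"
      then show "norm (f (t + h) / h) \<le> C * \<bar>h\<bar>"
        using assms[of "t + h"] by (simp add: field_simps power2_eq_square)
    qed
    show "((\<lambda>h. C * \<bar>h\<bar>) \<longlongrightarrow> 0) (at 0)" by (auto intro!: tendsto_eq_intros)
  qed
  then show ?thesis using \<open>f t = 0\<close> by (simp add: DERIV_def)
qed

text \<open>Put \<open>s = t * (1 - t)\<close>, the polynomial \<open>[:0,1,-1:]\<close>, with
  derivative \<open>[:1,-2:]\<close>. The three summands come from \<open>q\<close>, from the power
  of \<open>s\<close> and from the exponential, brought to the denominator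
  \<open>s ^ (n + 2)\<close>. Outside the open interval the quadratic bound gives derivative
  0.\<close>

lemma bump_has_derivative:
  "(bump q n has_real_derivative
     bump (pderiv q * ([:0,1,-1:])^2 - smult (real n) (q * [:1,-2:] * [:0,1,-1:]) + q * [:1,-2:]) (n + 2) t) (at t)"
proof (cases "t \<in> {0<..<1}")
  case True
  define s where "s = t * (1 - t)"
  have s: "s > 0" using True by (simp add: s_def)
  have "((\<lambda>t. poly q t / (t * (1 - t)) ^ n * exp (- (1 / (t * (1 - t))))) has_real_derivative
     ((poly (pderiv q) t * s ^ n - poly q t * (real n * s ^ (n - 1) * (1 - 2 * t))) / (s ^ n * s ^ n)) * exp (- (1 / s))
      + poly q t / s ^ n * (exp (- (1 / s)) * ((1 - 2 * t) / s\<^sup>2))) (at t)"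
  proof -
    have ds: "((\<lambda>t. t * (1 - t)) has_real_derivative (1 - 2 * t)) (at t)"
      by (auto intro!: derivative_eq_intros simp: algebra_simps)
    have e: "((\<lambda>t. exp (- (1 / (t * (1 - t))))) has_real_derivative
        (exp (- (1 / s)) * ((1 - 2 * t) / s\<^sup>2))) (at t)"
      unfolding s_def
      by (rule DERIV_cong[OF DERIV_exp[THEN DERIV_chain2, OF DERIV_minus[OF DERIV_divide[OF DERIV_const ds]]]])
        (use s in \<open>force simp: s_def\<close>, simp add: power2_eq_square algebra_simps diff_divide_distrib)
    have p: "((\<lambda>t. poly q t / (t * (1 - t)) ^ n) has_real_derivative
       (poly (pderiv q) t * s ^ n - poly q t * (real n * s ^ (n - 1) * (1 - 2 * t))) / (s ^ n * s ^ n)) (at t)"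
      unfolding s_def
      by (rule DERIV_cong[OF DERIV_divide[OF poly_DERIV DERIV_power[OF ds]]])
        (use s in \<open>force simp: s_def\<close>, simp add: mult_ac)
    show ?thesis using DERIV_mult[OF p e] by (simp add: s_def algebra_simps)
  qed
  moreover have "((poly (pderiv q) t * s ^ n - poly q t * (real n * s ^ (n - 1) * (1 - 2 * t))) / (s ^ n * s ^ n)) * exp (- (1 / s))
      + poly q t / s ^ n * (exp (- (1 / s)) * ((1 - 2 * t) / s\<^sup>2)) =
     bump (pderiv q * ([:0,1,-1:])^2 - smult (real n) (q * [:1,-2:] * [:0,1,-1:]) + q * [:1,-2:]) (n + 2) t"
  proof -
    have p: "poly [:0,1,-1:] t = s" "poly [:1,-2:] t = 1 - 2 * t" by (auto simp: s_def algebra_simps)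
    \<comment> \<open>For \<open>n = 0\<close> the exponent \<open>n - 1\<close> is truncated to 0,
      but the factor \<open>real n\<close> vanishes.\<close>
    have r: "real n * s ^ (n - 1) = real n * s ^ n / s" using s by (cases n) auto
    have "(poly (pderiv q) t * s ^ n - poly q t * (real n * s ^ (n - 1) * (1 - 2 * t))) / (s ^ n * s ^ n)
       = (poly (pderiv q) t - poly q t * (real n / s * (1 - 2 * t))) / s ^ n"
      unfolding r using s by (simp add: field_simps)
    moreover have "poly (pderiv q * ([:0,1,-1:])^2 - smult (real n) (q * [:1,-2:] * [:0,1,-1:]) + q * [:1,-2:]) t
       = poly (pderiv q) t * s\<^sup>2 - real n * (poly q t * (1 - 2 * t) * s) + poly q t * (1 - 2 * t)"
      by (simp only: poly_add poly_diff poly_mult poly_smult poly_power p)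
    moreover have "(a - b * (real n / s * w)) / s ^ n * e + b / s ^ n * (e * (w / s\<^sup>2))
       = (a * s\<^sup>2 - real n * (b * w * s) + b * w) / s ^ (n + 2) * e" for a b w e
      using s by (simp add: field_simps power2_eq_square power_add)
    ultimately show ?thesis
      using True by (simp add: bump_def s_def[symmetric])
  qed
  ultimately have "((\<lambda>t. poly q t / (t * (1 - t)) ^ n * exp (- (1 / (t * (1 - t))))) has_real_derivative
     bump (pderiv q * ([:0,1,-1:])^2 - smult (real n) (q * [:1,-2:] * [:0,1,-1:]) + q * [:1,-2:]) (n + 2) t) (at t)"
    by simp
  then show ?thesis
    by (rule has_field_derivative_transform_within_open[where S = "{0<..<1}"]) (use True in \<open>auto simp: bump_def\<close>)
next
  case False
  obtain C where "\<And>x t. t \<notin> {0<..<1} \<Longrightarrow> \<bar>bump q n x\<bar> \<le> C * (x - t)\<^sup>2"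
    using bump_bound by blast
  then have "(bump q n has_real_derivative 0) (at t)"
    using False by (intro DERIV_zero_of_quadratic_bound) blast
  moreover have "bump r k t = 0" for r k using False by (auto simp: bump_def)
  ultimately show ?thesis by simp
qed

lemma Ck_on_bump: "Ck_on k UNIV (bump q n)"
proof (induction k arbitrary: q n)
  case 0
  show ?case using DERIV_continuous[OF bump_has_derivative]
    by (auto simp: continuous_on_eq_continuous_within)
next
  case (Suc k)
  show ?case
    using bump_has_derivative[of q n, unfolded has_field_derivative_def]
    by (rule Ck_on_SucI[OF axis_accumulating_UNIV])
       (use Ck_on_bounded_linear[OF axis_accumulating_UNIV bounded_linear_mult_left Suc.IH] in auto)
qed

text \<open>The step is the integral of the bump \<open>exp (- (1 / (t * (1 - t))))\<close>, divided
  by its total mass.\<close>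

lemma smooth_step_exists:
  obtains \<phi> :: "real \<Rightarrow> real" where "smooth_on UNIV \<phi>"
    "\<And>t. t \<le> 0 \<Longrightarrow> \<phi> t = 0" "\<And>t. 1 \<le> t \<Longrightarrow> \<phi> t = 1" "\<And>t. \<phi> t \<in> {0..1}"
proof -
  define b where "b = bump 1 0"
  have cont: "continuous_on S b" for S
    using Ck_on_bump[of 0 1 0] continuous_on_subset by (auto simp: b_def)
  have int: "b integrable_on {x..y}" for x y by (rule integrable_continuous_real[OF cont])
  have nonneg: "b t \<ge> 0" for t by (simp add: b_def bump_def)
  have zero: "b t = 0" if "t \<le> 0 \<or> 1 \<le> t" for t using that by (auto simp: b_def bump_def)
  define c where "c = integral {0..1} b"
  have "c \<noteq> 0"
  proof
    assume "c = 0"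
    then have "b (1/2) = 0" using integral_eq_0_iff[OF cont, of 0 1] nonneg by (auto simp: c_def)
    then show False by (simp add: b_def bump_def)
  qed
  moreover have "c \<ge> 0" unfolding c_def using nonneg int by (intro integral_nonneg) auto
  ultimately have c: "c > 0" by simp
  have null: "integral {x..y} b = 0" if "y \<le> 0 \<or> 1 \<le> x" for x y
    using that zero by (intro integral_unique has_integral_is_0) auto
  define F where "F t = integral {0..t} b" for t
  have F1: "F t = c" if "t \<ge> 1" for t
    using Henstock_Kurzweil_Integration.integral_combine[of 0 1 t b] int null[of t 1] that
    by (simp add: F_def c_def)
  have F01: "0 \<le> F t \<and> F t \<le> c" for t
  proof (cases "t \<le> 1")
    case True
    have "F t \<le> c" unfolding F_def c_def using True int nonneg by (intro integral_subset_le) auto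
    moreover have "0 \<le> F t" unfolding F_def using int nonneg by (intro integral_nonneg) auto
    ultimately show ?thesis by simp
  qed (use F1 c in auto)
  have Fd: "(F has_real_derivative b t) (at t)" for t
  proof -
    \<comment> \<open>The derivative of an integral in its upper limit is available inside an
      interval, so the lower limit is moved from 0 to \<open>-T\<close>, left of \<open>t\<close>;
      the bump vanishes in between.\<close>
    define T where "T = \<bar>t\<bar> + 1"
    have T: "T > 0" "t \<in> {-T<..<T}" by (auto simp: T_def)
    have "((\<lambda>u. integral {-T..u} b) has_real_derivative b t) (at t within {-T..T})"
      using T by (intro integral_has_real_derivative cont) auto
    then have "((\<lambda>u. integral {-T..u} b) has_real_derivative b t) (at t)"
      using T by (simp add: at_within_Icc_at)
    then show ?thesis
    proof (rule has_field_derivative_transform_within_open[where S = "{-T<..<T}"])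
      fix u assume u: "u \<in> {-T<..<T}"
      show "integral {-T..u} b = F u"
      proof (cases "u \<ge> 0")
        case True
        then show ?thesis
          using Henstock_Kurzweil_Integration.integral_combine[of "-T" 0 u b] int null[of 0 "-T"] T
          by (simp add: F_def)
      qed (use null in \<open>auto simp: F_def\<close>)
    qed (use T in auto)
  qed
  have "Ck_on k UNIV F" for k
  proof (rule Ck_on_Suc_imp, rule Ck_on_SucI[OF axis_accumulating_UNIV])
    show "(F has_derivative (\<lambda>v. b t * v)) (at t)" for t
      using Fd by (simp add: has_field_derivative_def)
    show "Ck_on k UNIV (\<lambda>t. b t * v)" for v
      unfolding b_def by (intro Ck_on_bounded_linear[OF axis_accumulating_UNIV bounded_linear_mult_left] Ck_on_bump)
  qed
  then have "Ck_on k UNIV (\<lambda>t. F t / c)" for k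
    by (rule Ck_on_bounded_linear[OF axis_accumulating_UNIV bounded_linear_divide])
  then have "smooth_on UNIV (\<lambda>t. F t / c)" by (simp add: smooth_on_def)
  then show ?thesis
  proof (rule that)
    show "F t / c = 0" if "t \<le> 0" for t using null that by (simp add: F_def)
    show "F t / c = 1" if "1 \<le> t" for t using F1 c that by simp
    show "F t / c \<in> {0..1}" for t using F01[of t] c by simp
  qed
qed

section \<open>The Poincare lemma and the symmetry of second derivatives\<close>

text \<open>The primitive is the integral of \<omega> along the segment from \<open>x0\<close> to
  \<open>x\<close>, differentiated under the integral sign. Convexity keeps the segments inside
  \<open>U\<close> and is also a hypothesis of the Leibniz rule.\<close>

lemma poincare_star_shaped:
  fixes \<omega> :: "'e::euclidean_space \<Rightarrow> 'e"
  assumes U: "open U" "convex U" "x0 \<in> U" and C1: "Ck_on 1 U \<omega>"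
    and sym: "\<And>z h k. z \<in> U \<Longrightarrow>
      frechet_derivative \<omega> (at z) h \<bullet> k = frechet_derivative \<omega> (at z) k \<bullet> h"
  obtains f where "\<And>x. x \<in> U \<Longrightarrow> (f has_derivative (\<lambda>h. \<omega> x \<bullet> h)) (at x)"
proof -
  define D where "D z = frechet_derivative \<omega> (at z)" for z
  have D: "(\<omega> has_derivative D z) (at z)" if "z \<in> U" for z
  proof -
    have "\<omega> differentiable (at z within U)" using C1 that by simp
    then show ?thesis by (simp add: frechet_derivative_works D_def at_within_open[OF that U(1)])
  qed
  have contD: "continuous_on U (\<lambda>z. D z v)" for v
  proof -
    have "continuous_on U (\<lambda>z. frechet_derivative \<omega> (at z within U) v)" using C1 by simp
    then show ?thesis by (rule continuous_on_eq) (simp add: D_def at_within_open[OF _ U(1)])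
  qed
  have cont\<omega>: "continuous_on U \<omega>" using Ck_on_imp_continuous_on[OF C1] .
  define seg where "seg x t = x0 + t *\<^sub>R (x - x0)" for x t
  have seg: "seg x t \<in> U" if "x \<in> U" "t \<in> {0..1}" for x t
  proof -
    have "seg x t = (1 - t) *\<^sub>R x0 + t *\<^sub>R x" by (simp add: seg_def algebra_simps)
    then show ?thesis using convexD_alt[OF U(2,3) that(1)] that(2) by simp
  qed
  \<comment> \<open>\<open>W x t\<close> is the gradient in \<open>x\<close> of the integrand below, and by symmetry also the
    derivative of \<open>t *\<^sub>R \<omega> (seg x t)\<close> in \<open>t\<close>.\<close>
  define W where "W x t = \<omega> (seg x t) + t *\<^sub>R (\<Sum>b\<in>Basis. ((x - x0) \<bullet> b) *\<^sub>R D (seg x t) b)" for x t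
  have contseg: "continuous_on (U \<times> {0..1}) (\<lambda>p. seg (fst p) (snd p))"
    unfolding seg_def by (intro continuous_intros)
  \<comment> \<open>\<open>Ck_on\<close> yields continuity of \<open>D z v\<close> in
    \<open>z\<close> for each fixed \<open>v\<close> only. \<open>W\<close> is therefore written
    with the basis vectors, which gives continuity jointly in \<open>x\<close> and
    \<open>t\<close>.\<close>
  have contW: "continuous_on (U \<times> {0..1}) (\<lambda>p. W (fst p) (snd p))"
    unfolding W_def
    by (intro continuous_intros continuous_on_compose2[OF cont\<omega> contseg] continuous_on_compose2[OF contD contseg])
      (auto intro: seg)
  have Dlin: "(\<Sum>b\<in>Basis. (v \<bullet> b) *\<^sub>R D z b) = D z v" if "z \<in> U" for z v
  proof -
    have "linear (D z)" using has_derivative_linear[OF D[OF that]] .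
    then have "D z (\<Sum>b\<in>Basis. (v \<bullet> b) *\<^sub>R b) = (\<Sum>b\<in>Basis. (v \<bullet> b) *\<^sub>R D z b)"
      by (simp add: linear_sum linear_scale)
    then show ?thesis by (simp add: euclidean_representation)
  qed
  have W: "W x t = \<omega> (seg x t) + t *\<^sub>R D (seg x t) (x - x0)" if "x \<in> U" "t \<in> {0..1}" for x t
    using Dlin[OF seg[OF that]] by (simp add: W_def)
  define f where "f x = integral (cbox 0 1) (\<lambda>t. \<omega> (seg x t) \<bullet> (x - x0))" for x
  have "(f has_derivative (\<lambda>h. \<omega> x \<bullet> h)) (at x)" if x: "x \<in> U" for x
  proof -
    have 1: "((\<lambda>x. \<omega> (seg x t) \<bullet> (x - x0)) has_derivative blinfun_apply (blinfun_inner_left (W x t))) (at x within U)"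
      if xt: "x \<in> U" "t \<in> cbox 0 1" for x t
    proof -
      have xt': "x \<in> U" "t \<in> {0..1}" using xt by auto
      have s: "((\<lambda>x. seg x t) has_derivative (\<lambda>h. t *\<^sub>R h)) (at x)"
        unfolding seg_def by (auto intro!: derivative_eq_intros)
      have "((\<lambda>x. \<omega> (seg x t)) has_derivative (\<lambda>h. D (seg x t) (t *\<^sub>R h))) (at x)"
        using has_derivative_compose[OF s D[OF seg[OF xt']]] .
      moreover have "((\<lambda>x. x - x0) has_derivative (\<lambda>h. h)) (at x)"
        by (auto intro!: derivative_eq_intros)
      ultimately have "((\<lambda>x. \<omega> (seg x t) \<bullet> (x - x0)) has_derivative
        (\<lambda>h. \<omega> (seg x t) \<bullet> h + D (seg x t) (t *\<^sub>R h) \<bullet> (x - x0))) (at x)"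
        by (rule has_derivative_inner)
      \<comment> \<open>Symmetry turns \<open>D (seg x t) h \<bullet> (x - x0)\<close> into
        \<open>D (seg x t) (x - x0) \<bullet> h\<close>, so the derivative becomes the inner product
        with \<open>W x t\<close>.\<close>
      moreover have "\<omega> (seg x t) \<bullet> h + D (seg x t) (t *\<^sub>R h) \<bullet> (x - x0) = blinfun_inner_left (W x t) h" for h
      proof -
        have "D (seg x t) (t *\<^sub>R h) = t *\<^sub>R D (seg x t) h"
          using has_derivative_linear[OF D[OF seg[OF xt']]] by (simp add: linear_scale)
        then show ?thesis
          using sym[OF seg[OF xt'], of h "x - x0"]
          by (simp add: W[OF xt'] D_def inner_add_left inner_add_right inner_commute)
      qed
      ultimately show ?thesis by (simp add: has_derivative_at_withinI)
    qed
    have 2: "(\<lambda>t. \<omega> (seg x t) \<bullet> (x - x0)) integrable_on cbox 0 1" if "x \<in> U" for x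
      unfolding cbox_interval
      by (intro integrable_continuous_real continuous_intros continuous_on_compose2[OF cont\<omega>])
        (auto simp: seg_def[symmetric] that seg, auto simp: seg_def intro!: continuous_intros)
    have 3: "continuous_on (U \<times> cbox 0 1) (\<lambda>(x, t). blinfun_inner_left (W x t))"
      using bounded_linear.continuous_on[OF bounded_linear_blinfun_inner_left contW]
      by (simp add: split_beta)
    have "(f has_derivative blinfun_apply (integral (cbox 0 1) (\<lambda>t. blinfun_inner_left (W x t)))) (at x within U)"
      unfolding f_def
      by (rule leibniz_rule[OF _ _ 3 x U(2)]) (use 1 2 in auto)
    moreover have "blinfun_apply (integral (cbox 0 1) (\<lambda>t. blinfun_inner_left (W x t))) h = \<omega> x \<bullet> h" for h
    proof -
      have intW: "(W x has_integral \<omega> x) {0..1}"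
      proof -
        \<comment> \<open>The factor \<open>t\<close> removes the boundary term at 0, and at 1 the
          segment has arrived at \<open>x\<close>.\<close>
        have "(W x has_integral (1 *\<^sub>R \<omega> (seg x 1) - 0 *\<^sub>R \<omega> (seg x 0))) {0..1}"
        proof (rule fundamental_theorem_of_calculus)
          fix t :: real assume t: "t \<in> {0..1}"
          have s: "((\<lambda>t. seg x t) has_derivative (\<lambda>s. s *\<^sub>R (x - x0))) (at t)"
            unfolding seg_def by (auto intro!: derivative_eq_intros)
          have "((\<lambda>t. \<omega> (seg x t)) has_derivative (\<lambda>s. D (seg x t) (s *\<^sub>R (x - x0)))) (at t)"
            using has_derivative_compose[OF s D[OF seg[OF x t]]] .
          moreover have "(\<lambda>s. D (seg x t) (s *\<^sub>R (x - x0))) = (\<lambda>s. s *\<^sub>R D (seg x t) (x - x0))"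
            using has_derivative_linear[OF D[OF seg[OF x t]]] by (simp add: linear_scale)
          ultimately have "((\<lambda>t. \<omega> (seg x t)) has_vector_derivative D (seg x t) (x - x0)) (at t)"
            by (simp add: has_vector_derivative_def)
          from has_vector_derivative_scaleR[OF DERIV_ident this]
          have "((\<lambda>t. t *\<^sub>R \<omega> (seg x t)) has_vector_derivative W x t) (at t)"
            by (simp add: W[OF x t] add.commute)
          then show "((\<lambda>t. t *\<^sub>R \<omega> (seg x t)) has_vector_derivative W x t) (at t within {0..1})"
            by (rule has_vector_derivative_at_within)
        qed simp
        then show ?thesis by (simp add: seg_def)
      qed
      have "((\<lambda>t. blinfun_inner_left (W x t)) has_integral blinfun_inner_left (\<omega> x)) {0..1}"
        using has_integral_linear[OF intW bounded_linear_blinfun_inner_left] by (simp add: o_def)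
      then show ?thesis by (simp add: integral_unique inner_commute)
    qed
    then have "blinfun_apply (integral (cbox 0 1) (\<lambda>t. blinfun_inner_left (W x t))) = (\<lambda>h. \<omega> x \<bullet> h)" ..
    ultimately show ?thesis by (simp only: at_within_open[OF x U(1)])
  qed
  then show ?thesis by (rule that)
qed

text \<open>The mean value theorem in direction \<open>h\<close>, applied to the difference in
  direction \<open>k\<close>, turns the second difference into \<open>s\<close> times an increment
  of \<omega> paired with \<open>h\<close>. Differentiability of \<omega> at the single point
  \<open>p\<close> then evaluates that increment.\<close>

lemma mixed_difference_quotient:
  fixes f :: "'e::euclidean_space \<Rightarrow> real" and \<omega> :: "'e \<Rightarrow> 'e"
  assumes "open U" "p \<in> U" "\<And>x. x \<in> U \<Longrightarrow> (f has_derivative (\<lambda>h. \<omega> x \<bullet> h)) (at x)"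
    and D: "(\<omega> has_derivative D) (at p)"
  shows "((\<lambda>s. (f (p + s *\<^sub>R h + s *\<^sub>R k) - f (p + s *\<^sub>R h) - f (p + s *\<^sub>R k) + f p) / s\<^sup>2) \<longlongrightarrow> D k \<bullet> h) (at_right 0)"
proof (rule tendstoI)
  fix \<epsilon> :: real assume "\<epsilon> > 0"
  define M where "M = norm h + norm k + 1"
  have M: "M > 0" by (simp add: M_def add_nonneg_pos)
  \<comment> \<open>Two first-order errors of size \<open>\<eta> * (s * M)\<close>, paired with a
    vector of norm at most \<open>M\<close>, add up to two thirds of
    \<open>s * \<epsilon>\<close>.\<close>
  define \<eta> where "\<eta> = \<epsilon> / (3 * M * M)"
  have \<eta>: "\<eta> > 0" using \<open>\<epsilon> > 0\<close> M by (simp add: \<eta>_def)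
  obtain d1 where d1: "d1 > 0" "\<And>y. norm (y - p) < d1 \<Longrightarrow> norm (\<omega> y - \<omega> p - D (y - p)) \<le> \<eta> * norm (y - p)"
    using D \<eta> unfolding has_derivative_at_alt by blast
  obtain d2 where d2: "d2 > 0" "ball p d2 \<subseteq> U" using assms(1,2) by (auto simp: open_contains_ball)
  define d where "d = min d1 d2 / M"
  have "d > 0" using d1 d2 M by (simp add: d_def)
  have lin: "linear D" using has_derivative_linear[OF D] .
  have main: "\<bar>(f (p + s *\<^sub>R h + s *\<^sub>R k) - f (p + s *\<^sub>R h) - f (p + s *\<^sub>R k) + f p) / s\<^sup>2 - D k \<bullet> h\<bar> < \<epsilon>"
    if s: "0 < s" "s < d" for s
  proof -
    have sM: "s * M < d1" "s * M < d2" using s M by (auto simp: d_def field_simps)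
    have near: "norm (t *\<^sub>R h + c *\<^sub>R k) < d1 \<and> p + t *\<^sub>R h + c *\<^sub>R k \<in> U \<and> norm (t *\<^sub>R h + c *\<^sub>R k) \<le> s * M"
      if "0 \<le> t" "t \<le> s" "0 \<le> c" "c \<le> s" for t c
    proof -
      have "norm (t *\<^sub>R h + c *\<^sub>R k) \<le> t * norm h + c * norm k"
        using norm_triangle_ineq[of "t *\<^sub>R h" "c *\<^sub>R k"] that by simp
      also have "\<dots> \<le> s * norm h + s * norm k" using that by (intro add_mono mult_right_mono) auto
      also have "\<dots> \<le> s * M" using s by (simp add: M_def algebra_simps)
      finally have *: "norm (t *\<^sub>R h + c *\<^sub>R k) \<le> s * M" .
      then have "p + t *\<^sub>R h + c *\<^sub>R k \<in> ball p d2" using sM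
        using dist_commute[of p "p + (t *\<^sub>R h + c *\<^sub>R k)"] by (simp add: dist_norm[of "_ + _"] add.assoc)
      with * sM d2 show ?thesis by auto
    qed
    define G where "G t = f (p + t *\<^sub>R h + s *\<^sub>R k) - f (p + t *\<^sub>R h)" for t
    have Gd: "(G has_derivative (\<lambda>r. r * ((\<omega> (p + t *\<^sub>R h + s *\<^sub>R k) - \<omega> (p + t *\<^sub>R h)) \<bullet> h))) (at t within {0..s})"
      if "0 \<le> t" "t \<le> s" for t
    proof -
      have l: "((\<lambda>t. p + t *\<^sub>R h + c *\<^sub>R k) has_derivative (\<lambda>r. r *\<^sub>R h)) (at t)" for c
        by (auto intro!: derivative_eq_intros)
      have e: "((\<lambda>t. f (p + t *\<^sub>R h + c *\<^sub>R k)) has_derivative (\<lambda>r. \<omega> (p + t *\<^sub>R h + c *\<^sub>R k) \<bullet> (r *\<^sub>R h))) (at t)"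
        if "0 \<le> c" "c \<le> s" for c
        by (rule has_derivative_compose[OF l assms(3)]) (use near[of t c] that \<open>0 \<le> t\<close> \<open>t \<le> s\<close> in auto)
      have "0 \<le> s" using s by simp
      have e0: "((\<lambda>t. f (p + t *\<^sub>R h)) has_derivative (\<lambda>r. \<omega> (p + t *\<^sub>R h) \<bullet> (r *\<^sub>R h))) (at t)"
        using e[OF order.refl \<open>0 \<le> s\<close>] by (simp only: scaleR_zero_left add_0_right)
      have "((\<lambda>t. f (p + t *\<^sub>R h + s *\<^sub>R k) - f (p + t *\<^sub>R h)) has_derivative
          (\<lambda>r. \<omega> (p + t *\<^sub>R h + s *\<^sub>R k) \<bullet> (r *\<^sub>R h) - \<omega> (p + t *\<^sub>R h) \<bullet> (r *\<^sub>R h))) (at t)"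
        by (rule has_derivative_diff[OF e[OF \<open>0 \<le> s\<close> order.refl] e0])
      moreover have "(\<lambda>r. \<omega> (p + t *\<^sub>R h + s *\<^sub>R k) \<bullet> (r *\<^sub>R h) - \<omega> (p + t *\<^sub>R h) \<bullet> (r *\<^sub>R h)) =
          (\<lambda>r. r * ((\<omega> (p + t *\<^sub>R h + s *\<^sub>R k) - \<omega> (p + t *\<^sub>R h)) \<bullet> h))"
        by (simp add: inner_diff_left right_diff_distrib)
      ultimately have "(G has_derivative (\<lambda>r. r * ((\<omega> (p + t *\<^sub>R h + s *\<^sub>R k) - \<omega> (p + t *\<^sub>R h)) \<bullet> h))) (at t)"
        by (simp only: G_def[abs_def])
      then show ?thesis by (rule has_derivative_at_withinI)
    qed
    obtain t where t: "t \<in> {0<..<s}" "G s - G 0 = s * ((\<omega> (p + t *\<^sub>R h + s *\<^sub>R k) - \<omega> (p + t *\<^sub>R h)) \<bullet> h)"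
      using mvt_simple[OF s(1) Gd] by auto
    let ?y = "p + t *\<^sub>R h + s *\<^sub>R k" and ?z = "p + t *\<^sub>R h"
    have y: "norm (\<omega> ?y - \<omega> p - D (t *\<^sub>R h + s *\<^sub>R k)) \<le> \<eta> * (s * M)"
    proof -
      have "norm (\<omega> ?y - \<omega> p - D (?y - p)) \<le> \<eta> * norm (?y - p)"
        using near[of t s] t s by (intro d1(2)) (auto simp: algebra_simps)
      also have "\<dots> \<le> \<eta> * (s * M)"
        using near[of t s] t s \<eta> by (intro mult_left_mono) (auto simp: algebra_simps)
      finally show ?thesis by (simp add: add.assoc)
    qed
    have z: "norm (\<omega> ?z - \<omega> p - D (t *\<^sub>R h)) \<le> \<eta> * (s * M)"
    proof -
      have "norm (\<omega> ?z - \<omega> p - D (?z - p)) \<le> \<eta> * norm (?z - p)"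
        using near[of t 0] t s by (intro d1(2)) auto
      also have "\<dots> \<le> \<eta> * (s * M)"
        using near[of t 0] t s \<eta> by (intro mult_left_mono) auto
      finally show ?thesis by simp
    qed
    have "D (t *\<^sub>R h + s *\<^sub>R k) - D (t *\<^sub>R h) = s *\<^sub>R D k"
      using lin by (simp add: linear_add linear_scale)
    \<comment> \<open>Both expansions are taken at \<open>p\<close>, because \<omega> need not be
      differentiable at the intermediate point; their linear parts differ by
      \<open>s *\<^sub>R D k\<close> exactly.\<close>
    then have eq: "\<omega> ?y - \<omega> ?z - s *\<^sub>R D k =
       (\<omega> ?y - \<omega> p - D (t *\<^sub>R h + s *\<^sub>R k)) - (\<omega> ?z - \<omega> p - D (t *\<^sub>R h))"
      by (simp add: algebra_simps)
    have "norm (\<omega> ?y - \<omega> ?z - s *\<^sub>R D k) \<le> 2 * (\<eta> * (s * M))"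
      unfolding eq by (rule order_trans[OF norm_triangle_ineq4]) (use y z in linarith)
    then have "\<bar>(\<omega> ?y - \<omega> ?z - s *\<^sub>R D k) \<bullet> h\<bar> \<le> (2 * (\<eta> * (s * M))) * M"
      by (intro order_trans[OF Cauchy_Schwarz_ineq2] mult_mono) (use \<eta> s M in \<open>auto simp: M_def\<close>)
    also have "\<dots> = s * (2 * \<epsilon> / 3)" using M by (simp add: \<eta>_def field_simps)
    also have "\<dots> < s * \<epsilon>" using s \<open>\<epsilon> > 0\<close> by simp
    finally have *: "\<bar>(\<omega> ?y - \<omega> ?z) \<bullet> h - s * (D k \<bullet> h)\<bar> < s * \<epsilon>" by (simp add: inner_diff_left)
    have "(f (p + s *\<^sub>R h + s *\<^sub>R k) - f (p + s *\<^sub>R h) - f (p + s *\<^sub>R k) + f p) / s\<^sup>2 - D k \<bullet> h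
        = (s * ((\<omega> ?y - \<omega> ?z) \<bullet> h)) / s\<^sup>2 - D k \<bullet> h"
      using t(2) by (simp add: G_def algebra_simps)
    also have "\<dots> = ((\<omega> ?y - \<omega> ?z) \<bullet> h - s * (D k \<bullet> h)) / s"
      using s by (simp add: power2_eq_square field_simps)
    finally show ?thesis using * s by (simp add: abs_divide pos_divide_less_eq mult.commute)
  qed
  show "\<forall>\<^sub>F s in at_right 0. dist ((f (p + s *\<^sub>R h + s *\<^sub>R k) - f (p + s *\<^sub>R h) - f (p + s *\<^sub>R k) + f p) / s\<^sup>2) (D k \<bullet> h) < \<epsilon>"
    unfolding eventually_at_right_field dist_real_def using main \<open>d > 0\<close> by blast
qed

text \<open>The second difference is symmetric in \<open>h\<close> and \<open>k\<close>, and its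
  limit is unique.\<close>

lemma gradient_derivative_symmetric:
  fixes f :: "'e::euclidean_space \<Rightarrow> real" and \<omega> :: "'e \<Rightarrow> 'e"
  assumes "open U" "p \<in> U" "\<And>x. x \<in> U \<Longrightarrow> (f has_derivative (\<lambda>h. \<omega> x \<bullet> h)) (at x)"
    and "(\<omega> has_derivative D) (at p)"
  shows "D h \<bullet> k = D k \<bullet> h"
proof -
  have "(\<lambda>s. (f (p + s *\<^sub>R k + s *\<^sub>R h) - f (p + s *\<^sub>R k) - f (p + s *\<^sub>R h) + f p) / s\<^sup>2) =
      (\<lambda>s. (f (p + s *\<^sub>R h + s *\<^sub>R k) - f (p + s *\<^sub>R h) - f (p + s *\<^sub>R k) + f p) / s\<^sup>2)"
    by (simp add: algebra_simps)
  from tendsto_unique[OF trivial_limit_at_right_real mixed_difference_quotient[OF assms, of k h, unfolded this]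
      mixed_difference_quotient[OF assms, of h k]]
  show ?thesis .
qed

section \<open>Monodromy on simply connected spaces\<close>

text \<open>\<open>P U f\<close> is to be read as: \<open>f\<close> is a primitive on
  \<open>U\<close>. Monodromy uses only that local primitives exist and that any two have the same
  increments near a common point, so neither the vector field nor differentiability appears.\<close>

locale local_primitives =
  fixes \<Omega> :: "'a::topological_space set" and P :: "'a set \<Rightarrow> ('a \<Rightarrow> real) \<Rightarrow> bool"
  assumes open_domain: "P U f \<Longrightarrow> open U"
    and local_existence: "p \<in> \<Omega> \<Longrightarrow> \<exists>U f. P U f \<and> p \<in> U"
    and local_uniqueness: "P U f \<Longrightarrow> P U' f' \<Longrightarrow> p \<in> U \<Longrightarrow> p \<in> U' \<Longrightarrow>
      \<forall>\<^sub>F q in nhds p. f q - f p = f' q - f' p"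
begin

text \<open>This is analytic continuation up to an additive constant: \<Phi> lifts \<open>h\<close>
  to the germs of primitives. The parameter space is left general so that paths and homotopies are
  treated alike, and only increments are compared, so \<open>h\<close> is never
  differentiated.\<close>

definition primitive_along :: "'k::topological_space set \<Rightarrow> ('k \<Rightarrow> 'a) \<Rightarrow> ('k \<Rightarrow> real) \<Rightarrow> bool" where
  "primitive_along K h \<Phi> \<longleftrightarrow>
     (\<forall>k\<in>K. \<forall>U f. P U f \<longrightarrow> h k \<in> U \<longrightarrow>
        (\<forall>\<^sub>F k' in at k within K. \<Phi> k' - \<Phi> k = f (h k') - f (h k)))"

lemma primitive_alongD:
  "primitive_along K h \<Phi> \<Longrightarrow> k \<in> K \<Longrightarrow> P U f \<Longrightarrow> h k \<in> U \<Longrightarrow>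
     \<forall>\<^sub>F k' in at k within K. \<Phi> k' - \<Phi> k = f (h k') - f (h k)"
  by (auto simp: primitive_along_def)

lemma primitive_along_local:
  assumes "P U f" "continuous_on K h" "h ` K \<subseteq> U"
  shows "primitive_along K h (f \<circ> h)"
  unfolding primitive_along_def
proof (intro ballI allI impI)
  fix k U' f' assume k: "k \<in> K" and P': "P U' f'" "h k \<in> U'"
  have "(h \<longlongrightarrow> h k) (at k within K)" using assms(2) k by (simp add: continuous_on_def)
  moreover have "\<forall>\<^sub>F q in nhds (h k). f q - f (h k) = f' q - f' (h k)"
    using local_uniqueness[OF assms(1) P'(1)] assms(3) P'(2) k by blast
  ultimately have "\<forall>\<^sub>F k' in at k within K. f (h k') - f (h k) = f' (h k') - f' (h k)"
    unfolding filterlim_def le_filter_def eventually_filtermap by blast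
  then show "\<forall>\<^sub>F k' in at k within K. (f \<circ> h) k' - (f \<circ> h) k = f' (h k') - f' (h k)"
    by simp
qed

lemma primitive_along_add_const:
  "primitive_along K h \<Phi> \<Longrightarrow> primitive_along K h (\<lambda>k. \<Phi> k + c)"
  by (simp add: primitive_along_def)

lemma primitive_along_cong:
  assumes "primitive_along K h \<Phi>" "\<And>k. k \<in> K \<Longrightarrow> \<Phi> k = \<Psi> k" "\<And>k. k \<in> K \<Longrightarrow> h k = h' k"
  shows "primitive_along K h' \<Psi>"
  unfolding primitive_along_def
proof (intro ballI allI impI)
  fix k U f assume k: "k \<in> K" "P U f" "h' k \<in> U"
  have "\<forall>\<^sub>F k' in at k within K. \<Phi> k' - \<Phi> k = f (h k') - f (h k)"
    using primitive_alongD[OF assms(1)] k assms(3) by simp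
  moreover have "\<forall>\<^sub>F k' in at k within K. k' \<in> K"
    by (auto simp: eventually_at_filter)
  ultimately show "\<forall>\<^sub>F k' in at k within K. \<Psi> k' - \<Psi> k = f (h' k') - f (h' k)"
    by eventually_elim (use assms k in auto)
qed

lemma primitive_along_pullback:
  assumes "primitive_along K h \<Phi>" "continuous_on K' \<sigma>" "\<sigma> ` K' \<subseteq> K"
  shows "primitive_along K' (h \<circ> \<sigma>) (\<Phi> \<circ> \<sigma>)"
  unfolding primitive_along_def
proof (intro ballI allI impI)
  fix k U f assume k: "k \<in> K'" "P U f" "(h \<circ> \<sigma>) k \<in> U"
  have "\<forall>\<^sub>F k' in at (\<sigma> k) within K. \<Phi> k' - \<Phi> (\<sigma> k) = f (h k') - f (h (\<sigma> k))"
    using primitive_alongD[OF assms(1)] k assms(3) by auto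
  then obtain S where S: "open S" "\<sigma> k \<in> S"
    "\<And>x. x \<in> S \<Longrightarrow> x \<noteq> \<sigma> k \<Longrightarrow> x \<in> K \<Longrightarrow> \<Phi> x - \<Phi> (\<sigma> k) = f (h x) - f (h (\<sigma> k))"
    by (auto simp: eventually_at_topological)
  have "(\<sigma> \<longlongrightarrow> \<sigma> k) (at k within K')" using assms(2) k by (simp add: continuous_on_def)
  then have "\<forall>\<^sub>F k' in at k within K'. \<sigma> k' \<in> S" using S by (auto dest: topological_tendstoD)
  moreover have "\<forall>\<^sub>F k' in at k within K'. k' \<in> K'"
    by (auto simp: eventually_at_filter)
  ultimately show "\<forall>\<^sub>F k' in at k within K'. (\<Phi> \<circ> \<sigma>) k' - (\<Phi> \<circ> \<sigma>) k = f ((h \<circ> \<sigma>) k') - f ((h \<circ> \<sigma>) k)"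
  proof eventually_elim
    case (elim k')
    \<comment> \<open>The filter at \<open>\<sigma> k\<close> is punctured; if
      \<open>\<sigma> k'\<close> equals \<open>\<sigma> k\<close>, both sides are 0.\<close>
    then show ?case using S(3)[of "\<sigma> k'"] assms(3) by (cases "\<sigma> k' = \<sigma> k") auto
  qed
qed

text \<open>The difference of two continuations is locally constant, hence constant on the connected
  set \<open>K\<close>.\<close>

lemma primitive_along_unique:
  assumes "primitive_along K h \<Phi>" "primitive_along K h \<Psi>" "connected K" "h ` K \<subseteq> \<Omega>" "a \<in> K" "b \<in> K"
  shows "\<Phi> b - \<Phi> a = \<Psi> b - \<Psi> a"
proof -
  have "\<Phi> a - \<Psi> a = \<Phi> b - \<Psi> b"
  proof (rule connected_local_const[OF assms(3,5,6)], intro ballI)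
    fix k assume k: "k \<in> K"
    then obtain U f where "P U f" "h k \<in> U" using local_existence assms(4) by blast
    from primitive_alongD[OF assms(1) k this] primitive_alongD[OF assms(2) k this]
    show "\<forall>\<^sub>F k' in at k within K. \<Phi> k - \<Psi> k = \<Phi> k' - \<Psi> k'"
      by eventually_elim simp
  qed
  then show ?thesis by simp
qed

text \<open>On the connected overlap the two continuations differ by one constant, and shifting the
  second by it makes them agree there.\<close>

lemma primitive_along_glue:
  assumes \<Phi>: "primitive_along K1 h \<Phi>" and \<Psi>: "primitive_along K2 h \<Psi>"
    and closed: "closed K1" "closed K2" and conn: "connected (K1 \<inter> K2)" and img: "h ` (K1 \<union> K2) \<subseteq> \<Omega>"
  shows "\<exists>\<Xi>. primitive_along (K1 \<union> K2) h \<Xi>"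
proof -
  \<comment> \<open>The constant is read off at a chosen point of the overlap; with empty overlap
    any shift works and 0 is taken.\<close>
  define c where "c = (if K1 \<inter> K2 = {} then 0 else \<Phi> (SOME k. k \<in> K1 \<inter> K2) - \<Psi> (SOME k. k \<in> K1 \<inter> K2))"
  have agree: "\<Psi> k + c = \<Phi> k" if "k \<in> K1" "k \<in> K2" for k
  proof -
    let ?k0 = "SOME k. k \<in> K1 \<inter> K2"
    have k0: "?k0 \<in> K1 \<inter> K2" by (rule someI[of _ k]) (use that in auto)
    have sub: "primitive_along (K1 \<inter> K2) h \<Phi>" "primitive_along (K1 \<inter> K2) h \<Psi>"
      using primitive_along_pullback[OF \<Phi>, of "K1 \<inter> K2" id] primitive_along_pullback[OF \<Psi>, of "K1 \<inter> K2" id]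
      by (auto simp: continuous_on_id)
    have "\<Phi> k - \<Phi> ?k0 = \<Psi> k - \<Psi> ?k0"
      using primitive_along_unique[OF sub conn _ k0] img that by auto
    moreover have "c = \<Phi> ?k0 - \<Psi> ?k0" using that by (auto simp: c_def)
    ultimately show ?thesis by simp
  qed
  define \<Xi> where "\<Xi> k = (if k \<in> K1 then \<Phi> k else \<Psi> k + c)" for k
  have 1: "primitive_along K1 h \<Xi>"
    by (rule primitive_along_cong[OF \<Phi>]) (auto simp: \<Xi>_def)
  have 2: "primitive_along K2 h \<Xi>"
    by (rule primitive_along_cong[OF primitive_along_add_const[OF \<Psi>, of c]]) (auto simp: \<Xi>_def agree)
  \<comment> \<open>Closedness of the pieces makes the condition vacuous for a piece not containing
    \<open>k\<close>, so the filter within the union splits without cases on the position of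
    \<open>k\<close>.\<close>
  have triv: "at k within K = bot" if "closed K" "k \<notin> K" for k and K :: "'b set"
    using that by (metis closed_limpt trivial_limit_within)
  have "primitive_along (K1 \<union> K2) h \<Xi>"
    unfolding primitive_along_def
  proof (intro ballI allI impI)
    fix k U f assume k: "k \<in> K1 \<union> K2" and P: "P U f" "h k \<in> U"
    have "\<forall>\<^sub>F k' in at k within K1. \<Xi> k' - \<Xi> k = f (h k') - f (h k)"
      using primitive_alongD[OF 1 _ P] triv[OF closed(1)] by (cases "k \<in> K1") auto
    moreover have "\<forall>\<^sub>F k' in at k within K2. \<Xi> k' - \<Xi> k = f (h k') - f (h k)"
      using primitive_alongD[OF 2 _ P] triv[OF closed(2)] by (cases "k \<in> K2") auto
    ultimately show "\<forall>\<^sub>F k' in at k within (K1 \<union> K2). \<Xi> k' - \<Xi> k = f (h k') - f (h k)"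
      by (simp add: at_within_union eventually_sup)
  qed
  then show ?thesis by blast
qed

lemma primitive_along_glue_convex:
  fixes Q R1 R2 :: "'k::real_normed_vector set"
  assumes "convex Q" "closed Q" and img: "h ` Q \<subseteq> \<Omega>"
    and "closed R1" "closed R2" "convex (R1 \<inter> R2)"
    and \<Phi>: "\<exists>\<Phi>. primitive_along (R1 \<inter> Q) h \<Phi>" "\<exists>\<Phi>. primitive_along (R2 \<inter> Q) h \<Phi>"
  shows "\<exists>\<Phi>. primitive_along ((R1 \<union> R2) \<inter> Q) h \<Phi>"
proof -
  have "connected ((R1 \<inter> R2) \<inter> Q)" by (intro convex_connected convex_Int assms)
  moreover have "(R1 \<inter> R2) \<inter> Q = (R1 \<inter> Q) \<inter> (R2 \<inter> Q)" by blast
  ultimately have conn: "connected ((R1 \<inter> Q) \<inter> (R2 \<inter> Q))" by (simp only:)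
  have cl: "closed (R1 \<inter> Q)" "closed (R2 \<inter> Q)" using assms by auto
  have "h ` (R1 \<inter> Q \<union> R2 \<inter> Q) \<subseteq> \<Omega>" using img by blast
  with \<Phi> obtain \<Xi> where "primitive_along (R1 \<inter> Q \<union> R2 \<inter> Q) h \<Xi>"
    using primitive_along_glue[OF _ _ cl conn] by blast
  then show ?thesis by (auto simp: Int_Un_distrib2)
qed

text \<open>
  Bisection in the second coordinate yields a primitive on a thin strip around \<open>{s} \<times> {0..1}\<close>, and bisection
  in the first coordinate glues the strips.
\<close>

lemma primitive_along_rectangle:
  fixes h :: "real \<times> real \<Rightarrow> 'a"
  assumes cont: "continuous_on ({0..1} \<times> {0..1}) h" and img: "h ` ({0..1} \<times> {0..1}) \<subseteq> \<Omega>"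
  shows "\<exists>\<Phi>. primitive_along ({0..1} \<times> {0..1}) h \<Phi>"
proof -
  \<comment> \<open>Bisection tests intervals around a boundary point that may stick out of the unit
    square, so every rectangle is cut down to the square.\<close>
  define ok where "ok a b c d \<longleftrightarrow> (\<exists>\<Phi>. primitive_along (({a..b} \<times> {c..d}) \<inter> ({0..1} \<times> {0..1})) h \<Phi>)" for a b c d
  note glue = primitive_along_glue_convex[OF _ _ img, OF convex_Times closed_Times]
  have "(0::real) \<le> 1" by simp
  then have "ok 0 1 0 1"
  proof (induct rule: Bolzano[where P = "\<lambda>a b. ok a b 0 1"])
    case (trans a b c)
    have "{a..b} \<union> {b..c} = {a..c}" using trans(3,4) by auto
    moreover have "convex ({a..b} \<times> {0..1::real} \<inter> {b..c} \<times> {0..1})"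
      by (intro convex_Int convex_Times) auto
    ultimately show ?case
      using glue[of "{a..b} \<times> {0..1}" "{b..c} \<times> {0..1}"] trans(1,2)
      by (simp add: ok_def closed_Times flip: Sigma_Un_distrib1)
  next
    case (local s)
    \<comment> \<open>The width \<delta> of the strip may depend on the range of the second
      coordinate; joining two ranges keeps the smaller width.\<close>
    define Q where "Q c d \<longleftrightarrow> (\<exists>\<delta>>0. \<forall>a b. a \<le> s \<and> s \<le> b \<and> b - a < \<delta> \<longrightarrow> ok a b c d)" for c d
    have "(0::real) \<le> 1" by simp
    then have "Q 0 1"
    proof (induct rule: Bolzano)
      case (trans c d e)
      then obtain \<delta>1 \<delta>2 where \<delta>: "\<delta>1 > 0" "\<delta>2 > 0"
        "\<And>a b. a \<le> s \<and> s \<le> b \<and> b - a < \<delta>1 \<Longrightarrow> ok a b c d"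
        "\<And>a b. a \<le> s \<and> s \<le> b \<and> b - a < \<delta>2 \<Longrightarrow> ok a b d e"
        unfolding Q_def by metis
      have "ok a b c e" if ab: "a \<le> s \<and> s \<le> b \<and> b - a < min \<delta>1 \<delta>2" for a b
      proof -
        have "{c..d} \<union> {d..e} = {c..e}" using trans(3,4) by auto
        moreover have "convex ({a..b} \<times> {c..d} \<inter> {a..b} \<times> {d..e})"
          by (intro convex_Int convex_Times) auto
        moreover have "ok a b c d" "ok a b d e" using ab \<delta>(3,4)[of a b] by auto
        ultimately show ?thesis
          using glue[of "{a..b} \<times> {c..d}" "{a..b} \<times> {d..e}"]
          by (simp add: ok_def closed_Times flip: Sigma_Un_distrib2)
      qed
      then show ?case unfolding Q_def using \<delta>(1,2) by (intro exI[of _ "min \<delta>1 \<delta>2"]) auto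
    next
      case (local t)
      have st: "(s, t) \<in> {0..1} \<times> {0..1}" using local \<open>0 \<le> s\<close> \<open>s \<le> 1\<close> by auto
      then obtain U f where U: "P U f" "h (s, t) \<in> U" using local_existence img by blast
      then obtain W where W: "open W" "W \<inter> ({0..1} \<times> {0..1}) = h -` U \<inter> ({0..1} \<times> {0..1})"
        using cont open_domain unfolding continuous_on_open_invariant by metis
      with st U have "(s, t) \<in> W" by auto
      then obtain A B where AB: "open A" "open B" "(s, t) \<in> A \<times> B" "A \<times> B \<subseteq> W"
        using W(1) open_prod_elim by metis
      then obtain r r' where r: "r > 0" "ball s r \<subseteq> A" "r' > 0" "ball t r' \<subseteq> B"
        by (meson mem_Sigma_iff open_contains_ball)
      have "ok a b c d" if "a \<le> s" "s \<le> b" "b - a < r" "c \<le> t" "t \<le> d" "d - c < r'" for a b c d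
      proof -
        have "{a..b} \<subseteq> ball s r" "{c..d} \<subseteq> ball t r'" using that by (auto simp: dist_real_def)
        then have "({a..b} \<times> {c..d}) \<inter> ({0..1} \<times> {0..1}) \<subseteq> h -` U" using r AB W(2) by blast
        then show ?thesis unfolding ok_def
          using primitive_along_local[OF U(1), of "({a..b} \<times> {c..d}) \<inter> ({0..1} \<times> {0..1})" h] cont
          by (meson continuous_on_subset image_subset_iff_subset_vimage inf_le2)
      qed
      then show ?case unfolding Q_def using r by metis
    qed
    then show ?case unfolding Q_def by blast
  qed
  then show ?thesis by (simp add: ok_def)
qed

text \<open>A path is a homotopy constant in its first coordinate, so the rectangle covers this
  case.\<close>

lemma primitive_along_path:
  assumes "path \<gamma>" "path_image \<gamma> \<subseteq> \<Omega>"
  shows "\<exists>\<Phi>. primitive_along {0..1} \<gamma> \<Phi>"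
proof -
  have "continuous_on ({0..1::real} \<times> {0..1}) (\<gamma> \<circ> snd)"
    using assms(1) by (intro continuous_on_compose continuous_intros) (auto simp: path_def)
  moreover have "(\<gamma> \<circ> snd) ` ({0..1::real} \<times> {0..1}) \<subseteq> \<Omega>"
    using assms(2) by (auto simp: path_image_def)
  ultimately obtain \<Phi> where "primitive_along ({0..1::real} \<times> {0..1}) (\<gamma> \<circ> snd) \<Phi>"
    using primitive_along_rectangle by blast
  then have "primitive_along {0..1} ((\<gamma> \<circ> snd) \<circ> Pair (0::real)) (\<Phi> \<circ> Pair 0)"
    by (rule primitive_along_pullback) (auto intro!: continuous_intros)
  then show ?thesis by (auto simp: o_def)
qed

text \<open>The substitute for the line integral along a merely continuous path; existence and
  uniqueness of continuations up to a constant make the description definite for paths in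
  \<Omega>.\<close>

definition increment :: "(real \<Rightarrow> 'a) \<Rightarrow> real" where
  "increment \<gamma> = (THE c. \<forall>\<Phi>. primitive_along {0..1} \<gamma> \<Phi> \<longrightarrow> \<Phi> 1 - \<Phi> 0 = c)"

lemma increment_eq:
  assumes "path \<gamma>" "path_image \<gamma> \<subseteq> \<Omega>" "primitive_along {0..1} \<gamma> \<Phi>"
  shows "increment \<gamma> = \<Phi> 1 - \<Phi> 0"
proof -
  have "\<Psi> 1 - \<Psi> 0 = \<Phi> 1 - \<Phi> 0" if "primitive_along {0..1} \<gamma> \<Psi>" for \<Psi>
    using primitive_along_unique[OF that assms(3)] assms(2) by (auto simp: path_image_def)
  then show ?thesis unfolding increment_def using assms(3) by (intro the_equality) metis+
qed

lemma increment_local: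
  assumes "P U f" "path \<gamma>" "path_image \<gamma> \<subseteq> U" "path_image \<gamma> \<subseteq> \<Omega>"
  shows "increment \<gamma> = f (pathfinish \<gamma>) - f (pathstart \<gamma>)"
  using increment_eq[OF assms(2,4) primitive_along_local[OF assms(1)]] assms(2,3)
  by (auto simp: path_def path_image_def pathfinish_def pathstart_def)

text \<open>One continuation along \<gamma> serves all of its reparametrisations, in particular the
  halves of a concatenation and the reversed path.\<close>

lemma increment_reparam:
  assumes "path \<gamma>" "path_image \<gamma> \<subseteq> \<Omega>" "primitive_along {0..1} \<gamma> \<Phi>"
    "continuous_on {0..1} \<sigma>" "\<sigma> ` {0..1} \<subseteq> {0..1}"
  shows "increment (\<gamma> \<circ> \<sigma>) = \<Phi> (\<sigma> 1) - \<Phi> (\<sigma> 0)"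
proof -
  have "path (\<gamma> \<circ> \<sigma>)" using assms(1,4,5) unfolding path_def
    by (blast intro: continuous_on_compose continuous_on_subset)
  moreover have "path_image (\<gamma> \<circ> \<sigma>) \<subseteq> \<Omega>" using assms(2,5) by (auto simp: path_image_def)
  ultimately show ?thesis
    using increment_eq[OF _ _ primitive_along_pullback[OF assms(3,4,5)]] by simp
qed

lemma increment_cong:
  assumes "\<And>t. t \<in> {0..1} \<Longrightarrow> \<gamma> t = \<gamma>' t" shows "increment \<gamma> = increment \<gamma>'"
  using primitive_along_cong[of "{0..1}" \<gamma> _ _ \<gamma>'] primitive_along_cong[of "{0..1}" \<gamma>' _ _ \<gamma>] assms
  unfolding increment_def by metis

lemma increment_join:
  assumes "path \<gamma>" "path_image \<gamma> \<subseteq> \<Omega>" "path \<gamma>'" "path_image \<gamma>' \<subseteq> \<Omega>" "pathfinish \<gamma> = pathstart \<gamma>'"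
  shows "increment (\<gamma> +++ \<gamma>') = increment \<gamma> + increment \<gamma>'"
proof -
  have j: "path (\<gamma> +++ \<gamma>')" "path_image (\<gamma> +++ \<gamma>') \<subseteq> \<Omega>"
    using assms by (auto simp: subset_path_image_join)
  then obtain \<Phi> where \<Phi>: "primitive_along {0..1} (\<gamma> +++ \<gamma>') \<Phi>" using primitive_along_path by blast
  have "increment ((\<gamma> +++ \<gamma>') \<circ> (\<lambda>t. t / 2)) = \<Phi> (1/2) - \<Phi> 0"
    by (subst increment_reparam[OF j \<Phi>]) (auto intro!: continuous_intros)
  moreover have "increment ((\<gamma> +++ \<gamma>') \<circ> (\<lambda>t. t / 2 + 1 / 2)) = \<Phi> 1 - \<Phi> (1/2)"
    by (subst increment_reparam[OF j \<Phi>]) (auto intro!: continuous_intros)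
  moreover have "increment ((\<gamma> +++ \<gamma>') \<circ> (\<lambda>t. t / 2)) = increment \<gamma>"
    by (rule increment_cong) (auto simp: joinpaths_def)
  moreover have "increment ((\<gamma> +++ \<gamma>') \<circ> (\<lambda>t. t / 2 + 1 / 2)) = increment \<gamma>'"
  proof (rule increment_cong)
    \<comment> \<open>At \<open>t = 0\<close> the concatenation is evaluated at 1/2, where it still
      follows the first path; the matching end points settle this case.\<close>
    fix t :: real assume "t \<in> {0..1}"
    then show "((\<gamma> +++ \<gamma>') \<circ> (\<lambda>t. t / 2 + 1 / 2)) t = \<gamma>' t"
      using assms(5) by (cases "t = 0") (auto simp: joinpaths_def pathfinish_def pathstart_def field_simps)
  qed
  ultimately show ?thesis using increment_eq[OF j \<Phi>] by simp
qed

lemma increment_reversepath: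
  assumes "path \<gamma>" "path_image \<gamma> \<subseteq> \<Omega>"
  shows "increment (reversepath \<gamma>) = - increment \<gamma>"
proof -
  obtain \<Phi> where \<Phi>: "primitive_along {0..1} \<gamma> \<Phi>" using primitive_along_path assms by blast
  have "increment (\<gamma> \<circ> (\<lambda>t. 1 - t)) = \<Phi> 0 - \<Phi> 1"
    by (subst increment_reparam[OF assms \<Phi>]) (auto intro!: continuous_intros)
  then show ?thesis using increment_eq[OF assms \<Phi>] by (simp add: reversepath_def o_def)
qed

text \<open>
  Along a homotopy \<open>h\<close> through loops, \<open>\<Phi> (s, 1)\<close> and \<open>\<Phi> (s, 0)\<close> are primitives along the same path of base
  points, so their difference does not depend on \<open>s\<close>.
\<close>

lemma increment_loop:
  assumes "simply_connected \<Omega>" "path \<gamma>" "path_image \<gamma> \<subseteq> \<Omega>" "pathfinish \<gamma> = pathstart \<gamma>"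
  shows "increment \<gamma> = 0"
proof -
  define a where "a = pathstart \<gamma>"
  have a: "a \<in> \<Omega>" using assms(3) pathstart_in_path_image[of \<gamma>] by (auto simp: a_def)
  have "path (\<lambda>_::real. a)" "path_image (\<lambda>_::real. a) \<subseteq> \<Omega>"
    using a by (auto simp: path_def path_image_def)
  \<comment> \<open>Simple connectedness makes any two loops freely homotopic; the second one is
    taken constant. The base point may move during the homotopy.\<close>
  then have "homotopic_loops \<Omega> \<gamma> (\<lambda>_. a)"
    using assms unfolding simply_connected_def by (simp add: pathfinish_def pathstart_def)
  then obtain h where h: "continuous_on ({0..1::real} \<times> {0..1::real}) h" "h \<in> ({0..1} \<times> {0..1}) \<rightarrow> \<Omega>"
    "\<And>x. x \<in> {0..1} \<Longrightarrow> h (0, x) = \<gamma> x" "\<And>x. x \<in> {0..1} \<Longrightarrow> h (1, x) = a"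
    "\<And>t. t \<in> {0..1} \<Longrightarrow> h (t, 1) = h (t, 0)"
    unfolding homotopic_loops by (auto simp: pathfinish_def pathstart_def)
  have himg: "h ` ({0..1} \<times> {0..1}) \<subseteq> \<Omega>" using h(2) by auto
  obtain \<Phi> where \<Phi>: "primitive_along ({0..1} \<times> {0..1}) h \<Phi>"
    using primitive_along_rectangle[OF h(1) himg] by blast
  have 1: "primitive_along {0..1} (h \<circ> (\<lambda>s. (s, 1))) (\<Phi> \<circ> (\<lambda>s. (s, 1)))"
    by (rule primitive_along_pullback[OF \<Phi>]) (auto intro!: continuous_intros)
  have "primitive_along {0..1} (h \<circ> (\<lambda>s. (s, 0))) (\<Phi> \<circ> (\<lambda>s. (s, 0)))"
    by (rule primitive_along_pullback[OF \<Phi>]) (auto intro!: continuous_intros)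
  then have 0: "primitive_along {0..1} (h \<circ> (\<lambda>s. (s, 1))) (\<Phi> \<circ> (\<lambda>s. (s, 0)))"
    by (rule primitive_along_cong) (auto simp: h(5))
  have "(\<Phi> \<circ> (\<lambda>s. (s, 1))) 1 - (\<Phi> \<circ> (\<lambda>s. (s, 1))) 0 = (\<Phi> \<circ> (\<lambda>s. (s, 0))) 1 - (\<Phi> \<circ> (\<lambda>s. (s, 0))) 0"
    using himg by (intro primitive_along_unique[OF 1 0]) auto
  moreover
  have v: "primitive_along {0..1} (h \<circ> Pair s) (\<Phi> \<circ> Pair s)" if "s \<in> {0..1}" for s
    using that by (intro primitive_along_pullback[OF \<Phi>]) (auto intro!: continuous_intros)
  have "\<Phi> (0, 1) - \<Phi> (0, 0) = increment \<gamma>"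
    using increment_eq[OF assms(2,3) primitive_along_cong[OF v[of 0] refl]] h(3) by simp
  \<comment> \<open>The homotopy ends in a constant loop, whose continuations are constant by
    uniqueness.\<close>
  moreover have "\<Phi> (1, 1) - \<Phi> (1, 0) = 0"
  proof -
    obtain U f where U: "P U f" "a \<in> U" using local_existence a by blast
    have "primitive_along {0..1} (\<lambda>_::real. a) (\<Phi> \<circ> Pair 1)"
      by (rule primitive_along_cong[OF v]) (auto simp: h(4))
    moreover have "primitive_along {0..1} (\<lambda>_::real. a) (f \<circ> (\<lambda>_. a))"
      using U by (intro primitive_along_local) auto
    ultimately show ?thesis
      using primitive_along_unique[of "{0..1}" "\<lambda>_. a" "\<Phi> \<circ> Pair 1" "f \<circ> (\<lambda>_. a)" 0 1] a by auto
  qed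
  ultimately show ?thesis by simp
qed

end

text \<open>The constant loops at \<open>a\<close> and \<open>b\<close> are freely homotopic, and
  the track of the base point joins \<open>a\<close> to \<open>b\<close>.\<close>

lemma simply_connected_imp_path_connected_topological:
  fixes \<Omega> :: "'a::topological_space set"
  assumes "simply_connected \<Omega>" shows "path_connected \<Omega>"
  unfolding path_connected_def
proof (intro ballI)
  fix a b assume "a \<in> \<Omega>" "b \<in> \<Omega>"
  then have "path (\<lambda>_::real. a)" "path_image (\<lambda>_::real. a) \<subseteq> \<Omega>"
    "path (\<lambda>_::real. b)" "path_image (\<lambda>_::real. b) \<subseteq> \<Omega>"
    by (auto simp: path_def path_image_def)
  then have "homotopic_loops \<Omega> (\<lambda>_. a) (\<lambda>_. b)"
    using assms unfolding simply_connected_def by (simp add: pathfinish_def pathstart_def)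
  then obtain h where h: "continuous_on ({0..1::real} \<times> {0..1::real}) h" "h \<in> ({0..1} \<times> {0..1}) \<rightarrow> \<Omega>"
    "\<And>x. x \<in> {0..1} \<Longrightarrow> h (0, x) = a" "\<And>x. x \<in> {0..1} \<Longrightarrow> h (1, x) = b"
    unfolding homotopic_loops by auto
  have "path (h \<circ> (\<lambda>s. (s, 0)))"
    unfolding path_def by (intro continuous_on_compose continuous_on_subset[OF h(1)] continuous_intros) auto
  moreover have "path_image (h \<circ> (\<lambda>s. (s, 0))) \<subseteq> \<Omega>" using h(2) by (auto simp: path_image_def)
  ultimately show "\<exists>g. path g \<and> path_image g \<subseteq> \<Omega> \<and> pathstart g = a \<and> pathfinish g = b"
    using h(3,4) by (intro exI[of _ "h \<circ> (\<lambda>s. (s, 0))"]) (auto simp: pathstart_def pathfinish_def)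
qed

context local_primitives
begin

text \<open>The value at \<open>x\<close> is the increment along any path from a base point; two
  choices form a loop, which has increment 0. Near \<open>p\<close> such a path is prolonged inside
  a small path-connected neighbourhood, where the increment is that of the local primitive.\<close>

lemma global_primitive_exists:
  assumes sc: "simply_connected \<Omega>" and "open \<Omega>"
    and lpc: "\<And>p N. open N \<Longrightarrow> p \<in> N \<Longrightarrow> p \<in> \<Omega> \<Longrightarrow> \<exists>N'. open N' \<and> p \<in> N' \<and> N' \<subseteq> N \<and> path_connected N'"
  obtains u where "\<And>p U f. p \<in> \<Omega> \<Longrightarrow> P U f \<Longrightarrow> p \<in> U \<Longrightarrow> \<forall>\<^sub>F q in nhds p. u q - u p = f q - f p"
proof (cases "\<Omega> = {}")
  case True
  with that show ?thesis by blast
next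
  case False
  then obtain x0 where x0: "x0 \<in> \<Omega>" by blast
  define joins where "joins \<gamma> x y \<longleftrightarrow> path \<gamma> \<and> path_image \<gamma> \<subseteq> \<Omega> \<and> pathstart \<gamma> = x \<and> pathfinish \<gamma> = y" for \<gamma> x y
  have ex: "\<exists>\<gamma>. joins \<gamma> x0 x" if "x \<in> \<Omega>" for x
    using simply_connected_imp_path_connected_topological[OF sc] x0 that
    unfolding path_connected_def joins_def by blast
  have indep: "increment \<gamma> = increment \<gamma>'" if "joins \<gamma> x y" "joins \<gamma>' x y" for \<gamma> \<gamma>' x y
  proof -
    have "increment (\<gamma> +++ reversepath \<gamma>') = 0"
      using that unfolding joins_def by (intro increment_loop sc) (auto simp: subset_path_image_join)
    then show ?thesis
      using that increment_join[of \<gamma> "reversepath \<gamma>'"] increment_reversepath[of \<gamma>'] by (auto simp: joins_def)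
  qed
  define u where "u x = increment (SOME \<gamma>. joins \<gamma> x0 x)" for x
  have u: "u x = increment \<gamma>" if "joins \<gamma> x0 x" for x \<gamma>
    unfolding u_def using indep someI[of "\<lambda>\<gamma>. joins \<gamma> x0 x", OF that] that by blast
  have "\<forall>\<^sub>F q in nhds p. u q - u p = f q - f p" if p: "p \<in> \<Omega>" and P: "P U f" "p \<in> U" for p U f
  proof -
    have "open (U \<inter> \<Omega>)" "p \<in> U \<inter> \<Omega>" using open_domain[OF P(1)] \<open>open \<Omega>\<close> P p by auto
    then obtain N where N: "open N" "p \<in> N" "N \<subseteq> U \<inter> \<Omega>" "path_connected N" using lpc p by meson
    have "u q - u p = f q - f p" if q: "q \<in> N" for q
    proof -
      obtain \<gamma> where \<gamma>: "joins \<gamma> x0 p" using ex p by blast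
      obtain \<beta> where \<beta>: "path \<beta>" "path_image \<beta> \<subseteq> N" "pathstart \<beta> = p" "pathfinish \<beta> = q"
        using N(2,4) q unfolding path_connected_def by blast
      have \<beta>': "path_image \<beta> \<subseteq> U" "path_image \<beta> \<subseteq> \<Omega>" using \<beta>(2) N(3) by auto
      have "joins (\<gamma> +++ \<beta>) x0 q" using \<gamma> \<beta> \<beta>' by (auto simp: joins_def subset_path_image_join)
      then have "u q = increment \<gamma> + increment \<beta>"
        using u[of "\<gamma> +++ \<beta>" q] increment_join[of \<gamma> \<beta>] \<gamma> \<beta> \<beta>' by (simp add: joins_def)
      then show ?thesis using u[OF \<gamma>] increment_local[OF P(1) \<beta>(1) \<beta>'] \<beta> by simp
    qed
    then show ?thesis using N(1,2) by (auto simp: eventually_nhds)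
  qed
  with that show ?thesis by blast
qed

end

section \<open>Charts and tangent vectors\<close>

lemma frechet_derivative_axis_sum:
  fixes f :: "real ^ 'm::finite \<Rightarrow> real"
  assumes "f differentiable (at y)"
  shows "(\<Sum>i\<in>UNIV. a $ i * frechet_derivative f (at y) (axis i 1)) = frechet_derivative f (at y) a"
proof -
  have "linear (frechet_derivative f (at y))" by (rule linear_frechet_derivative[OF assms])
  then have "frechet_derivative f (at y) (\<Sum>i\<in>UNIV. a $ i *\<^sub>R axis i 1) = (\<Sum>i\<in>UNIV. a $ i * frechet_derivative f (at y) (axis i 1))"
    by (simp add: linear_sum linear_scale)
  moreover have "(\<Sum>i\<in>UNIV. a $ i *\<^sub>R axis i 1) = a"
    using basis_expansion[of a] by (simp add: scalar_mult_eq_scaleR)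
  ultimately show ?thesis by simp
qed

locale manifold =
  fixes A :: "('a::topological_space, 'm::finite) chart set"
  assumes atlas: "smooth_atlas A"
begin

lemma chart: "c \<in> A \<Longrightarrow> is_chart c"
  using atlas by (simp add: smooth_atlas_def)

lemma chart_around: "\<exists>c\<in>A. p \<in> fst c"
  using atlas unfolding smooth_atlas_def by blast

lemma chart_open: "c \<in> A \<Longrightarrow> open (fst c)"
  using chart by (simp add: is_chart_def)

lemma chart_homeomorphism:
  assumes "c \<in> A"
  shows "homeomorphism (fst c) (snd c ` fst c) (snd c) (chart_inv c)"
proof -
  obtain \<psi> where \<psi>: "homeomorphism (fst c) (snd c ` fst c) (snd c) \<psi>"
    using chart[OF assms] by (auto simp: is_chart_def)
  then have "inj_on (snd c) (fst c)" by (metis homeomorphism_def inj_on_inverseI)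
  then have "chart_inv c y = \<psi> y" if "y \<in> snd c ` fst c" for y
    using that \<psi> by (auto simp: chart_inv_def inv_into_f_f homeomorphism_apply1)
  then show ?thesis using homeomorphism_cong[OF \<psi>] by metis
qed

lemma chart_inv_chart [simp]: "c \<in> A \<Longrightarrow> p \<in> fst c \<Longrightarrow> chart_inv c (snd c p) = p"
  using chart_homeomorphism by (meson homeomorphism_apply1)

lemma continuous_on_chart: "c \<in> A \<Longrightarrow> continuous_on (fst c) (snd c)"
  using chart_homeomorphism by (auto simp: homeomorphism_def)

lemma continuous_on_chart_inv: "c \<in> A \<Longrightarrow> continuous_on (snd c ` fst c) (chart_inv c)"
  using chart_homeomorphism by (auto simp: homeomorphism_def)

lemma chart_image_open:
  assumes "c \<in> A" "open W" shows "open (snd c ` (fst c \<inter> W))"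
proof -
  have "openin (top_of_set (snd c ` fst c)) (snd c ` (fst c \<inter> W))"
    using homeomorphism_imp_open_map[OF chart_homeomorphism[OF assms(1)]] assms(2) by (simp add: openin_open_Int)
  then show ?thesis using chart[OF assms(1)] openin_open_trans unfolding is_chart_def by blast
qed

lemma open_chart_preimage:
  assumes "c \<in> A" "open B" shows "open (fst c \<inter> snd c -` B)"
  using continuous_on_chart[OF assms(1)] chart_open[OF assms(1)] assms(2)
  by (auto simp: continuous_on_open_vimage Int_commute)

lemma eventually_nhds_chart:
  assumes "c \<in> A" "p \<in> fst c" "\<forall>\<^sub>F y in nhds (snd c p). Q (chart_inv c y)"
  shows "\<forall>\<^sub>F q in nhds p. Q q"
proof -
  obtain B where B: "open B" "snd c p \<in> B" "\<And>y. y \<in> B \<Longrightarrow> Q (chart_inv c y)"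
    using assms(3) by (auto simp: eventually_nhds)
  show ?thesis unfolding eventually_nhds
    using open_chart_preimage[OF assms(1) B(1)] B assms(1,2)
    by (intro exI[of _ "fst c \<inter> snd c -` B"]) (auto dest: B(3))
qed

lemma Ck_on_transition:
  "c \<in> A \<Longrightarrow> d \<in> A \<Longrightarrow> Ck_on k (snd c ` (fst c \<inter> fst d)) (snd d \<circ> chart_inv c)"
  using atlas by (auto simp: smooth_atlas_def smooth_on_def)

lemma transition_differentiable:
  assumes "c \<in> A" "d \<in> A" "p \<in> fst c" "p \<in> fst d"
  shows "(snd d \<circ> chart_inv c) differentiable (at (snd c p))"
proof -
  have "open (snd c ` (fst c \<inter> fst d))" by (intro chart_image_open chart_open assms)
  moreover have "snd c p \<in> snd c ` (fst c \<inter> fst d)" using assms by auto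
  ultimately show ?thesis
    using Ck_on_transition[OF assms(1,2), of 1] by (metis One_nat_def Ck_on.simps(2) at_within_open)
qed

definition transition_derivative :: "('a, 'm) chart \<Rightarrow> ('a, 'm) chart \<Rightarrow> 'a \<Rightarrow> real ^ 'm \<Rightarrow> real ^ 'm" where
  "transition_derivative c d p = frechet_derivative (snd d \<circ> chart_inv c) (at (snd c p))"

lemma transition_has_derivative:
  assumes "c \<in> A" "d \<in> A" "p \<in> fst c" "p \<in> fst d"
  shows "((snd d \<circ> chart_inv c) has_derivative transition_derivative c d p) (at (snd c p))"
  using transition_differentiable[OF assms] unfolding transition_derivative_def frechet_derivative_works .

lemma has_derivative_change_chart:
  assumes c: "c \<in> A" and d: "d \<in> A" and p: "p \<in> fst c" "p \<in> fst d"
    and u: "((u \<circ> chart_inv d) has_derivative D) (at (snd d p))"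
  shows "((u \<circ> chart_inv c) has_derivative (D \<circ> transition_derivative c d p)) (at (snd c p))"
proof -
  have "((u \<circ> chart_inv d) \<circ> (snd d \<circ> chart_inv c) has_derivative (D \<circ> transition_derivative c d p)) (at (snd c p))"
    using u c p by (intro diff_chain_at transition_has_derivative assms) simp
  then show ?thesis
    by (rule has_derivative_transform_within_open[where s = "snd c ` (fst c \<inter> fst d)"])
      (use c d p in \<open>auto intro!: chart_image_open chart_open\<close>)
qed

text \<open>The chain rule for the transition maps carries differentiability from one chart to every
  chart around the point.\<close>

lemma differentiable_at_iff:
  assumes c: "c \<in> A" "p \<in> fst c"
  shows "differentiable_at A u p \<longleftrightarrow> (u \<circ> chart_inv c) differentiable (at (snd c p))"
proof
  assume "(u \<circ> chart_inv c) differentiable (at (snd c p))"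
  then show "differentiable_at A u p"
    unfolding differentiable_at_def differentiable_def using has_derivative_change_chart[OF _ c(1) _ c(2)] by blast
qed (use assms in \<open>auto simp: differentiable_at_def\<close>)

lemma coord_combination_eq:
  assumes "c \<in> A" "p \<in> fst c"
  shows "coord_combination A c p a =
    (\<lambda>u. if differentiable_at A u p then frechet_derivative (u \<circ> chart_inv c) (at (snd c p)) a else 0)"
proof (rule ext)
  fix u
  show "coord_combination A c p a u =
    (if differentiable_at A u p then frechet_derivative (u \<circ> chart_inv c) (at (snd c p)) a else 0)"
    using frechet_derivative_axis_sum[of "u \<circ> chart_inv c" "snd c p" a] differentiable_at_iff[OF assms]
    by (auto simp: coord_combination_def coord_vector_def coord_partial_def)
qed

lemma coord_combination_apply:
  assumes "c \<in> A" "p \<in> fst c" "((u \<circ> chart_inv c) has_derivative D) (at (snd c p))"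
  shows "coord_combination A c p a u = D a"
  using assms(3) differentiable_at_iff[OF assms(1,2), of u] frechet_derivative_at[OF assms(3)]
  by (auto simp: coord_combination_eq[OF assms(1,2)] differentiable_def)

text \<open>On differentiable functions this is the chain rule; on all others both operators are 0,
  because differentiability does not depend on the chart.\<close>

lemma coord_combination_change_chart:
  assumes c: "c \<in> A" and d: "d \<in> A" and p: "p \<in> fst c" "p \<in> fst d"
  shows "coord_combination A c p a = coord_combination A d p (transition_derivative c d p a)"
proof (rule ext)
  fix u
  show "coord_combination A c p a u = coord_combination A d p (transition_derivative c d p a) u"
  proof (cases "differentiable_at A u p")
    case True
    then obtain D where D: "((u \<circ> chart_inv d) has_derivative D) (at (snd d p))"
      using differentiable_at_iff[OF d p(2)] by (auto simp: differentiable_def)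
    show ?thesis
      using coord_combination_apply[OF d p(2) D] coord_combination_apply[OF c p(1) has_derivative_change_chart[OF c d p D]]
      by simp
  next
    case False
    then show ?thesis by (simp add: coord_combination_eq[OF c p(1)] coord_combination_eq[OF d p(2)])
  qed
qed

lemma tangent_space_eq:
  assumes "c \<in> A" "p \<in> fst c"
  shows "tangent_space A p = range (coord_combination A c p)"
proof
  show "tangent_space A p \<subseteq> range (coord_combination A c p)"
  proof
    fix v assume "v \<in> tangent_space A p"
    then obtain d a where d: "d \<in> A" "p \<in> fst d" "v = coord_combination A d p a"
      by (auto simp: tangent_space_def)
    show "v \<in> range (coord_combination A c p)"
      using coord_combination_change_chart[OF d(1) assms(1) d(2) assms(2), of a] d(3) by simp
  qed
  show "range (coord_combination A c p) \<subseteq> tangent_space A p"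
    using assms by (auto simp: tangent_space_def)
qed

lemma coord_combination_linear:
  "coord_combination A c p (r *\<^sub>R a + s *\<^sub>R b) =
     (\<lambda>u. r * coord_combination A c p a u + s * coord_combination A c p b u)"
  by (rule ext) (simp add: coord_combination_def sum_distrib_left sum.distrib algebra_simps)

lemma coord_combination_0: "coord_combination A c p 0 = (\<lambda>u. 0)"
  by (rule ext) (simp add: coord_combination_def)

lemma coord_combination_axis: "coord_combination A c p (axis i 1) = coord_vector A c i p"
  by (rule ext) (simp add: coord_combination_def axis_def if_distrib[of "\<lambda>x. x * _"] cong: if_cong)

text \<open>Applied to the coordinate functions of \<open>c\<close>, the operator returns its
  coefficients.\<close>

lemma coord_combination_inject:
  assumes c: "c \<in> A" "p \<in> fst c" and eq: "coord_combination A c p a = coord_combination A c p b"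
  shows "a = b"
proof -
  have "coord_combination A c p a (\<lambda>q. snd c q $ i) = a $ i" for a i
  proof (rule coord_combination_apply[OF c])
    have "((\<lambda>y. y $ i) has_derivative (\<lambda>y. y $ i)) (at (snd c p))"
      by (rule bounded_linear_imp_has_derivative) (rule bounded_linear_vec_nth)
    \<comment> \<open>The values of \<open>snd c\<close> off its domain are arbitrary, so the
      comparison with the linear projection is made on the open chart image only.\<close>
    then show "((\<lambda>q. snd c q $ i) \<circ> chart_inv c has_derivative (\<lambda>y. y $ i)) (at (snd c p))"
      by (rule has_derivative_transform_within_open[where s = "snd c ` (fst c \<inter> UNIV)"])
        (use c in \<open>auto intro: chart_image_open[of _ UNIV, simplified]\<close>)
  qed
  with eq show ?thesis by (metis vec_eq_iff)
qed

lemma components_coord_combination: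
  assumes "c \<in> A" "p \<in> fst c"
  shows "components A c p (coord_combination A c p a) = a"
  unfolding components_def using coord_combination_inject[OF assms] by (intro the_equality) auto

lemma coord_combination_components:
  assumes "c \<in> A" "p \<in> fst c" "v \<in> tangent_space A p"
  shows "coord_combination A c p (components A c p v) = v"
  using assms(3) components_coord_combination[OF assms(1,2)] by (auto simp: tangent_space_eq[OF assms(1,2)])

end

section \<open>The metric in coordinates\<close>

locale riemannian = manifold A for A :: "('a::{t2_space, second_countable_topology}, 'm::finite) chart set" +
  fixes g :: "'a metric_tensor"
  assumes riemannian: "riemannian_manifold A g"
begin

lemma inner_product: "inner_product_on (tangent_space A p) (g p)"
  using riemannian by (simp add: riemannian_manifold_def)

lemma metric_sym: "v \<in> tangent_space A p \<Longrightarrow> w \<in> tangent_space A p \<Longrightarrow> g p v w = g p w v"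
  using inner_product[of p] by (auto simp: inner_product_on_def)

lemma metric_linear_left:
  "v \<in> tangent_space A p \<Longrightarrow> v' \<in> tangent_space A p \<Longrightarrow> w \<in> tangent_space A p \<Longrightarrow>
     g p (\<lambda>u. r * v u + s * v' u) w = r * g p v w + s * g p v' w"
  using inner_product[of p] unfolding inner_product_on_def by blast

lemma metric_pos: "v \<in> tangent_space A p \<Longrightarrow> v \<noteq> (\<lambda>u. 0) \<Longrightarrow> g p v v > 0"
  using inner_product[of p] unfolding inner_product_on_def by blast

text \<open>The metric read on coefficient vectors; its matrix is formed by
  \<open>metric_coeff\<close>. Linear algebra thereby moves from spaces of operators to
  \<open>real ^ 'm\<close>.\<close>

definition gram :: "('a, 'm) chart \<Rightarrow> 'a \<Rightarrow> real ^ 'm \<Rightarrow> real ^ 'm \<Rightarrow> real" where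
  "gram c p a b = g p (coord_combination A c p a) (coord_combination A c p b)"

context
  fixes c p assumes c: "c \<in> A" "p \<in> fst c"
begin

lemma in_tangent_space [simp]: "coord_combination A c p a \<in> tangent_space A p"
  by (simp add: tangent_space_eq[OF c])

lemma gram_commute: "gram c p a b = gram c p b a"
  by (simp add: gram_def metric_sym)

lemma gram_linear_left: "linear (\<lambda>a. gram c p a b)"
proof (rule linearI)
  have *: "gram c p (r *\<^sub>R a + s *\<^sub>R a') b = r * gram c p a b + s * gram c p a' b" for r s a a'
    by (simp add: gram_def coord_combination_linear metric_linear_left)
  show "gram c p (a + a') b = gram c p a b + gram c p a' b" for a a' using *[of 1 a 1 a'] by simp
  show "gram c p (r *\<^sub>R a) b = r *\<^sub>R gram c p a b" for r a using *[of r a 0 a] by simp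
qed

lemma gram_linear_right: "linear (\<lambda>b. gram c p a b)"
  using gram_linear_left[of a] by (simp add: gram_commute[of a])

lemma gram_self_eq_0: "gram c p a a = 0 \<Longrightarrow> a = 0"
  using metric_pos[OF in_tangent_space[of a]] coord_combination_inject[OF c, of a 0]
  by (fastforce simp: gram_def coord_combination_0)

lemma gram_sum_right: "gram c p a b = (\<Sum>i\<in>UNIV. b $ i * gram c p a (axis i 1))"
proof -
  have "gram c p a (\<Sum>i\<in>UNIV. b $ i *\<^sub>R axis i 1) = (\<Sum>i\<in>UNIV. b $ i * gram c p a (axis i 1))"
    by (simp add: linear_sum[OF gram_linear_right] linear_scale[OF gram_linear_right])
  moreover have "(\<Sum>i\<in>UNIV. b $ i *\<^sub>R axis i 1) = b"
    using basis_expansion[of b] by (simp add: scalar_mult_eq_scaleR)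
  ultimately show ?thesis by simp
qed

text \<open>This is the invertibility of the metric matrix: definiteness makes \<open>L\<close>
  injective, and finite dimension makes it surjective.\<close>

lemma gram_riesz:
  obtains a where "\<And>b. gram c p a b = \<xi> \<bullet> b"
proof -
  define L where "L a = (\<chi> i. gram c p a (axis i 1))" for a
  have L: "linear L"
    by (rule linearI) (simp_all add: L_def vec_eq_iff linear_add[OF gram_linear_left] linear_scale[OF gram_linear_left])
  have "a = 0" if "L a = 0" for a
    using that gram_sum_right[of a a] by (intro gram_self_eq_0) (simp add: L_def vec_eq_iff)
  then have "inj L" using L by (simp add: linear_injective_0)
  then have "surj L" using L linear_injective_imp_surjective by blast
  then obtain a where "L a = \<xi>" by (metis surjD)
  then have "gram c p a b = \<xi> \<bullet> b" for b
    using gram_sum_right[of a b] by (auto simp: L_def inner_vec_def mult.commute)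
  then show ?thesis by (rule that)
qed

end

end

section \<open>Smooth curves\<close>

context manifold
begin

text \<open>The vector \<open>a\<close> is the derivative of the curve in the chart, one-sided at
  the end points, and it is the same for all \<open>u\<close>.\<close>

lemma curve_chart_derivative:
  assumes \<gamma>: "smooth_curve A \<gamma>" and t: "t \<in> {0..1}" and c: "c \<in> A" "\<gamma> t \<in> fst c"
  obtains a where
    "\<And>u D. ((u \<circ> chart_inv c) has_derivative D) (at (snd c (\<gamma> t))) \<Longrightarrow>
       ((u \<circ> \<gamma>) has_vector_derivative D a) (at t within {0..1})"
proof -
  define S where "S = {t\<in>{0..1}. \<gamma> t \<in> fst c}"
  have "continuous_on {0..1} \<gamma>" using \<gamma> by (simp add: smooth_curve_def path_def)
  then have "\<exists>T. open T \<and> T \<inter> {0..1} = \<gamma> -` fst c \<inter> {0..1}"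
    using chart_open[OF c(1)] by (simp only: continuous_on_open_invariant)
  then obtain T where T: "open T" "T \<inter> {0..1} = \<gamma> -` fst c \<inter> {0..1}"
    by blast
  have "S = \<gamma> -` fst c \<inter> {0..1}" by (auto simp: S_def)
  then have S: "S = {0..1} \<inter> T" by (metis T(2) Int_commute)
  have tS: "t \<in> S" using t c by (simp add: S_def)
  \<comment> \<open>The parameters lying in the chart form a relatively open part of
    \<open>{0..1}\<close>.\<close>
  have at: "at t within {0..1} = at t within S"
    by (rule at_within_nhd[of _ T]) (use tS T(1) in \<open>auto simp: S\<close>)
  have "Ck_on 1 S (snd c \<circ> \<gamma>)"
    using \<gamma> c unfolding smooth_curve_def smooth_on_def S_def by blast
  then have "(snd c \<circ> \<gamma>) differentiable (at t within S)" using tS by simp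
  then obtain a where a: "((snd c \<circ> \<gamma>) has_vector_derivative a) (at t within S)"
    by (meson vector_derivative_works)
  have "((u \<circ> \<gamma>) has_vector_derivative D a) (at t within {0..1})"
    if D: "((u \<circ> chart_inv c) has_derivative D) (at (snd c (\<gamma> t)))" for u D
  proof -
    have "((u \<circ> chart_inv c) \<circ> (snd c \<circ> \<gamma>) has_derivative (D \<circ> (\<lambda>s. s *\<^sub>R a))) (at t within S)"
      by (rule diff_chain_within) (use a D in \<open>auto simp: has_vector_derivative_def intro: has_derivative_at_withinI\<close>)
    moreover have "D \<circ> (\<lambda>s. s *\<^sub>R a) = (\<lambda>s. s *\<^sub>R D a)"
      using has_derivative_linear[OF D] by (simp add: fun_eq_iff linear_scale)
    ultimately have "((u \<circ> chart_inv c) \<circ> (snd c \<circ> \<gamma>) has_vector_derivative D a) (at t within S)"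
      by (simp only: has_vector_derivative_def)
    then have "((u \<circ> \<gamma>) has_vector_derivative D a) (at t within S)"
      by (rule has_vector_derivative_transform[OF tS, rotated]) (use c in \<open>auto simp: S_def\<close>)
    then show ?thesis by (simp only: at)
  qed
  then show ?thesis by (rule that)
qed

text \<open>\<open>velocity\<close> is defined separately for each \<open>u\<close>. Uniqueness of
  vector derivatives within \<open>{0..1}\<close> identifies it with one coordinate
  combination.\<close>

lemma velocity_eq:
  assumes \<gamma>: "smooth_curve A \<gamma>" and t: "t \<in> {0..1}"
  shows "velocity A \<gamma> t \<in> tangent_space A (\<gamma> t)"
    and "differentiable_at A u (\<gamma> t) \<Longrightarrow>
      ((u \<circ> \<gamma>) has_vector_derivative velocity A \<gamma> t u) (at t within {0..1})"
proof -
  obtain c where c: "c \<in> A" "\<gamma> t \<in> fst c" using chart_around by blast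
  obtain a where a: "\<And>(u :: 'a \<Rightarrow> real) D. ((u \<circ> chart_inv c) has_derivative D) (at (snd c (\<gamma> t))) \<Longrightarrow>
       ((u \<circ> \<gamma>) has_vector_derivative D a) (at t within {0..1})"
    using curve_chart_derivative[OF \<gamma> t c] by blast
  have *: "((u \<circ> \<gamma>) has_vector_derivative coord_combination A c (\<gamma> t) a u) (at t within {0..1})"
    if u: "differentiable_at A u (\<gamma> t)" for u
  proof -
    obtain D where D: "((u \<circ> chart_inv c) has_derivative D) (at (snd c (\<gamma> t)))"
      using u differentiable_at_iff[OF c] by (auto simp: differentiable_def)
    then show ?thesis using a[OF D] coord_combination_apply[OF c D] by simp
  qed
  have "velocity A \<gamma> t = coord_combination A c (\<gamma> t) a"
  proof (rule ext)
    fix u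
    have "vector_derivative (u \<circ> \<gamma>) (at t within {0..1}) = coord_combination A c (\<gamma> t) a u"
      if "differentiable_at A u (\<gamma> t)"
      using vector_derivative_within_cbox[of 0 1 t "u \<circ> \<gamma>"] *[OF that] t by auto
    then show "velocity A \<gamma> t u = coord_combination A c (\<gamma> t) a u"
      by (simp add: velocity_def coord_combination_eq[OF c])
  qed
  then show "velocity A \<gamma> t \<in> tangent_space A (\<gamma> t)"
    "differentiable_at A u (\<gamma> t) \<Longrightarrow>
      ((u \<circ> \<gamma>) has_vector_derivative velocity A \<gamma> t u) (at t within {0..1})"
    using * by (auto simp: tangent_space_eq[OF c])
qed

text \<open>Curves on the whole line, constant outside \<open>{0..1}\<close>: they can be run at any
  affine speed, reversed and concatenated without one-sided derivatives or corners.\<close>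

definition flat_curve :: "'a set \<Rightarrow> 'a \<Rightarrow> 'a \<Rightarrow> (real \<Rightarrow> 'a) \<Rightarrow> bool" where
  "flat_curve W x y \<gamma> \<longleftrightarrow> continuous_on UNIV \<gamma> \<and> (\<forall>c\<in>A. \<forall>k. Ck_on k {t. \<gamma> t \<in> fst c} (snd c \<circ> \<gamma>)) \<and>
     range \<gamma> \<subseteq> W \<and> (\<forall>t\<le>0. \<gamma> t = x) \<and> (\<forall>t\<ge>1. \<gamma> t = y)"

lemma open_curve_preimage:
  assumes "continuous_on UNIV (\<gamma> :: real \<Rightarrow> 'a)" "c \<in> A" shows "open {t. \<gamma> t \<in> fst c}"
  using continuous_open_vimage[OF chart_open[OF assms(2)], of \<gamma>] assms(1)
  by (simp add: continuous_on_eq_continuous_at vimage_def)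

lemma flat_curve_imp_curve_joining:
  assumes "flat_curve W x y \<gamma>" shows "curve_joining A W x y \<gamma>"
  unfolding curve_joining_def smooth_curve_def smooth_on_def
proof (intro conjI ballI allI)
  have cont: "continuous_on UNIV \<gamma>" using assms by (simp add: flat_curve_def)
  then show "path \<gamma>" by (auto simp: path_def intro: continuous_on_subset)
  fix c k assume c: "c \<in> A"
  have "{t\<in>{0..1}. \<gamma> t \<in> fst c} = {0..1} \<inter> {t. \<gamma> t \<in> fst c}" by auto
  then have "axis_accumulating {t\<in>{0..1}. \<gamma> t \<in> fst c}"
    using axis_accumulating_Int_open[OF axis_accumulating_unit_interval open_curve_preimage[OF cont c]] by simp
  then show "Ck_on k {t\<in>{0..1}. \<gamma> t \<in> fst c} (snd c \<circ> \<gamma>)"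
    using assms c unfolding flat_curve_def by (blast intro: Ck_on_subset)
qed (use assms in \<open>auto simp: flat_curve_def path_image_def pathstart_def pathfinish_def\<close>)

lemma Ck_on_curve_affine:
  assumes "flat_curve W x y \<gamma>" "c \<in> A"
  shows "continuous_on UNIV (\<lambda>t. \<gamma> (\<alpha> * t + \<beta>))"
    and "Ck_on k {t. \<gamma> (\<alpha> * t + \<beta>) \<in> fst c} (\<lambda>t. snd c (\<gamma> (\<alpha> * t + \<beta>)))"
proof -
  show cont: "continuous_on UNIV (\<lambda>t. \<gamma> (\<alpha> * t + \<beta>))"
    using assms(1) unfolding flat_curve_def
    by (elim conjE, elim continuous_on_compose2) (auto intro!: continuous_intros)
  have acc: "axis_accumulating {t. \<gamma> (\<alpha> * t + \<beta>) \<in> fst c}"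
    by (intro axis_accumulating_open open_curve_preimage[OF cont assms(2)])
  have "Ck_on k {t. \<gamma> t \<in> fst c} (snd c \<circ> \<gamma>)" using assms by (simp add: flat_curve_def)
  moreover have \<sigma>: "\<beta> + t *\<^sub>R \<alpha> = \<alpha> * t + \<beta>" for t by (simp add: mult.commute)
  have "(\<lambda>t. \<beta> + t *\<^sub>R \<alpha>) ` {t. \<gamma> (\<alpha> * t + \<beta>) \<in> fst c} \<subseteq> {t. \<gamma> t \<in> fst c}"
    unfolding \<sigma> by blast
  ultimately have "Ck_on k {t. \<gamma> (\<alpha> * t + \<beta>) \<in> fst c} ((snd c \<circ> \<gamma>) \<circ> (\<lambda>t. \<beta> + t *\<^sub>R \<alpha>))"
    by (rule Ck_on_compose[OF acc Ck_on_affine[OF acc]])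
  then show "Ck_on k {t. \<gamma> (\<alpha> * t + \<beta>) \<in> fst c} (\<lambda>t. snd c (\<gamma> (\<alpha> * t + \<beta>)))"
    by (simp only: o_def \<sigma>)
qed

lemma flat_curve_sym:
  assumes "flat_curve W x y \<gamma>" shows "flat_curve W y x (\<lambda>t. \<gamma> (-1 * t + 1))"
proof -
  obtain c where c: "c \<in> A" using chart_around by blast
  show ?thesis
    unfolding flat_curve_def o_def
    using Ck_on_curve_affine[OF assms, where \<alpha> = "-1" and \<beta> = 1] assms c
    by (intro conjI ballI allI) (auto simp: flat_curve_def)
qed

text \<open>
  Both curves run at triple speed, so that on \<open>{1/3..2/3}\<close> both formulas give the constant \<open>y\<close>, and the
  concatenation is smooth by locality.
\<close>

lemma flat_curve_trans:
  assumes 1: "flat_curve W x y \<gamma>" and 2: "flat_curve W y z \<gamma>'"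
  shows "flat_curve W x z (\<lambda>t. if t \<le> 1/2 then \<gamma> (3 * t + 0) else \<gamma>' (3 * t + (-2)))"
proof -
  define \<delta> where "\<delta> = (\<lambda>t. if t \<le> 1/2 then \<gamma> (3 * t + 0) else \<gamma>' (3 * t + (-2)))"
  have left: "\<delta> t = \<gamma> (3 * t + 0)" if "t < 2/3" for t
    using 1 2 that by (auto simp: flat_curve_def \<delta>_def)
  have right: "\<delta> t = \<gamma>' (3 * t + (-2))" if "t > 1/3" for t
    using 1 2 that by (auto simp: flat_curve_def \<delta>_def)
  obtain c0 where c0: "c0 \<in> A" using chart_around by blast
  have "continuous_on ({..<2/3} \<union> {1/3<..}) \<delta>"
  proof (rule continuous_on_open_Un)
    show "continuous_on {..<2/3} \<delta>"
      using continuous_on_subset[OF Ck_on_curve_affine(1)[OF 1 c0, of 3 0]] left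
      by (subst continuous_on_cong[OF refl left]) auto
    show "continuous_on {1/3<..} \<delta>"
      using continuous_on_subset[OF Ck_on_curve_affine(1)[OF 2 c0, of 3 "-2"]] right
      by (subst continuous_on_cong[OF refl right]) auto
  qed auto
  moreover have "{..<2/3} \<union> {1/3<..} = (UNIV :: real set)" by auto
  ultimately have cont: "continuous_on UNIV \<delta>" by (simp only:)
  have "Ck_on k {t. \<delta> t \<in> fst c} (\<lambda>t. snd c (\<delta> t))" if c: "c \<in> A" for c k
  proof (rule Ck_on_local)
    fix t assume t: "t \<in> {t. \<delta> t \<in> fst c}"
    have acc: "axis_accumulating ({t. \<delta> t \<in> fst c} \<inter> N)" if "open N" for N
      by (intro axis_accumulating_Int_open axis_accumulating_open open_curve_preimage cont c that)
    show "\<exists>N. open N \<and> t \<in> N \<and> Ck_on k ({t. \<delta> t \<in> fst c} \<inter> N) (\<lambda>t. snd c (\<delta> t))"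
    proof (cases "t < 2/3")
      case True
      have "Ck_on k ({t. \<delta> t \<in> fst c} \<inter> {..<2/3}) (\<lambda>t. snd c (\<gamma> (3 * t + 0)))"
        using left by (intro Ck_on_subset[OF Ck_on_curve_affine(2)[OF 1 c]] acc) auto
      then have "Ck_on k ({t. \<delta> t \<in> fst c} \<inter> {..<2/3}) (\<lambda>t. snd c (\<delta> t))"
        by (subst Ck_on_cong) (use left in auto)
      with True show ?thesis by (intro exI[of _ "{..<2/3}"]) auto
    next
      case False
      have "Ck_on k ({t. \<delta> t \<in> fst c} \<inter> {1/3<..}) (\<lambda>t. snd c (\<gamma>' (3 * t + (-2))))"
        using right by (intro Ck_on_subset[OF Ck_on_curve_affine(2)[OF 2 c]] acc) auto
      then have "Ck_on k ({t. \<delta> t \<in> fst c} \<inter> {1/3<..}) (\<lambda>t. snd c (\<delta> t))"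
        by (subst Ck_on_cong) (use right in auto)
      with False show ?thesis by (intro exI[of _ "{1/3<..}"]) auto
    qed
  qed
  moreover have "\<delta> t \<in> W" "t \<le> 0 \<Longrightarrow> \<delta> t = x" "t \<ge> 1 \<Longrightarrow> \<delta> t = z" for t
    using 1 2 by (auto simp: flat_curve_def \<delta>_def)
  ultimately have "flat_curve W x z \<delta>"
    unfolding flat_curve_def o_def using cont by blast
  then show ?thesis by (simp only: \<delta>_def)
qed

lemma chart_ball:
  assumes "c \<in> A" "p \<in> fst c" "open W" "p \<in> W"
  obtains r where "r > 0" "ball (snd c p) r \<subseteq> snd c ` (fst c \<inter> W)"
  using chart_image_open[OF assms(1,3)] assms(2,4) by (meson IntI image_eqI openE)

text \<open>In a chart ball the straight segment is traversed with the smooth step as its clock,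
  which is stationary before 0 and after 1.\<close>

lemma flat_curve_local:
  assumes "open W" "p \<in> W"
  shows "\<exists>N. open N \<and> p \<in> N \<and> N \<subseteq> W \<and> (\<forall>q\<in>N. \<exists>\<gamma>. flat_curve W p q \<gamma>)"
proof -
  obtain c where c: "c \<in> A" "p \<in> fst c" using chart_around by blast
  obtain r where r: "r > 0" "ball (snd c p) r \<subseteq> snd c ` (fst c \<inter> W)" using chart_ball[OF c assms] .
  define N where "N = fst c \<inter> snd c -` ball (snd c p) r"
  have inv: "chart_inv c y \<in> fst c \<inter> W \<and> snd c (chart_inv c y) = y" if "y \<in> ball (snd c p) r" for y
    using that r c by auto
  have NW: "N \<subseteq> W" using inv c by (fastforce simp: N_def)
  obtain \<phi> :: "real \<Rightarrow> real" where \<phi>: "smooth_on UNIV \<phi>"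
    "\<And>t. t \<le> 0 \<Longrightarrow> \<phi> t = 0" "\<And>t. 1 \<le> t \<Longrightarrow> \<phi> t = 1" "\<And>t. \<phi> t \<in> {0..1}"
    using smooth_step_exists by blast
  have "\<exists>\<gamma>. flat_curve W p q \<gamma>" if q: "q \<in> N" for q
  proof -
    define \<sigma> where "\<sigma> t = snd c p + \<phi> t *\<^sub>R (snd c q - snd c p)" for t
    define \<gamma> where "\<gamma> t = chart_inv c (\<sigma> t)" for t
    have \<sigma>: "\<sigma> t \<in> ball (snd c p) r" for t
    proof -
      have "\<sigma> t = (1 - \<phi> t) *\<^sub>R snd c p + \<phi> t *\<^sub>R snd c q" by (simp add: \<sigma>_def algebra_simps)
      moreover have "snd c q \<in> ball (snd c p) r" "snd c p \<in> ball (snd c p) r" using q r by (auto simp: N_def)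
      ultimately show ?thesis
        using convexD_alt[OF convex_ball, of "snd c p" "snd c p" r "snd c q" "\<phi> t"] \<phi>(4)[of t] by simp
    qed
    have Ck\<phi>: "Ck_on k UNIV \<phi>" for k using \<phi>(1) by (simp add: smooth_on_def)
    have Ck\<sigma>: "Ck_on k UNIV \<sigma>" for k
      unfolding \<sigma>_def by (intro Ck_on_add Ck_on_scaleR Ck_on_const Ck\<phi> axis_accumulating_UNIV)
    have cont: "continuous_on UNIV \<gamma>"
      unfolding \<gamma>_def
      by (rule continuous_on_compose2[OF continuous_on_chart_inv[OF c(1)] Ck_on_imp_continuous_on[OF Ck\<sigma>]])
        (use \<sigma> r in blast)
    have "Ck_on k {t. \<gamma> t \<in> fst d} (snd d \<circ> \<gamma>)" if d: "d \<in> A" for d k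
    proof -
      have acc: "axis_accumulating {t. \<gamma> t \<in> fst d}"
        by (intro axis_accumulating_open open_curve_preimage cont d)
      have "\<sigma> t \<in> snd c ` (fst c \<inter> fst d)" if "\<gamma> t \<in> fst d" for t
        using inv[OF \<sigma>[of t]] that by (metis IntD1 IntI \<gamma>_def image_eqI)
      then have "Ck_on k {t. \<gamma> t \<in> fst d} ((snd d \<circ> chart_inv c) \<circ> \<sigma>)"
        by (intro Ck_on_compose[OF acc _ Ck_on_transition[OF c(1) d]] Ck_on_subset[OF Ck\<sigma>] acc) auto
      then show ?thesis by (simp add: \<gamma>_def[abs_def] o_def)
    qed
    moreover have "\<gamma> t \<in> W" for t using inv[OF \<sigma>] by (simp add: \<gamma>_def)
    moreover have "\<gamma> t = p" if "t \<le> 0" for t using \<phi>(2)[OF that] c by (simp add: \<gamma>_def \<sigma>_def)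
    moreover have "\<gamma> t = q" if "t \<ge> 1" for t using \<phi>(3)[OF that] c q by (simp add: \<gamma>_def \<sigma>_def N_def)
    ultimately show ?thesis using cont by (auto simp: flat_curve_def)
  qed
  moreover have "open N" "p \<in> N" using open_chart_preimage[OF c(1)] c r by (auto simp: N_def)
  ultimately show ?thesis using NW by blast
qed

text \<open>Being joined by a flat curve is an equivalence relation on \<open>W\<close> in which
  every point has a neighbourhood of related points; a connected set is then a single class.\<close>

lemma curve_joining_exists:
  assumes "open W" "connected W" "x \<in> W" "y \<in> W"
  shows "\<exists>\<gamma>. curve_joining A W x y \<gamma>"
proof -
  have "\<exists>\<gamma>. flat_curve W x y \<gamma>"
  proof (rule connected_equivalence_relation[OF assms(2-4), where R = "\<lambda>x y. \<exists>\<gamma>. flat_curve W x y \<gamma>"])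
    show "\<exists>T. openin (top_of_set W) T \<and> a \<in> T \<and> (\<forall>x\<in>T. \<exists>\<gamma>. flat_curve W a x \<gamma>)" if "a \<in> W" for a
      using flat_curve_local[OF assms(1) that] by (meson open_openin_trans assms(1))
  qed (use flat_curve_sym flat_curve_trans in blast)+
  then show ?thesis using flat_curve_imp_curve_joining by blast
qed

lemma path_connected_neighbourhood:
  assumes "open (N :: 'a set)" "p \<in> N"
  shows "\<exists>N'. open N' \<and> p \<in> N' \<and> N' \<subseteq> N \<and> path_connected N'"
proof -
  obtain c where c: "c \<in> A" "p \<in> fst c" using chart_around by blast
  obtain r where r: "r > 0" "ball (snd c p) r \<subseteq> snd c ` (fst c \<inter> N)" using chart_ball[OF c assms] .
  let ?N' = "fst c \<inter> snd c -` ball (snd c p) r"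
  have inv: "chart_inv c y \<in> fst c \<inter> N \<and> snd c (chart_inv c y) = y" if "y \<in> ball (snd c p) r" for y
    using that r c by auto
  have N': "q \<in> N \<and> q \<in> chart_inv c ` ball (snd c p) r" if "q \<in> ?N'" for q
    using inv[of "snd c q"] that c by (metis IntD1 IntD2 chart_inv_chart image_eqI vimageD)
  have "chart_inv c ` ball (snd c p) r = ?N'"
    using inv N' by blast
  moreover have "path_connected (chart_inv c ` ball (snd c p) r)"
    using r by (intro path_connected_continuous_image continuous_on_subset[OF continuous_on_chart_inv[OF c(1)]]
        convex_imp_path_connected convex_ball) auto
  moreover have "?N' \<subseteq> N" using N' by blast
  ultimately show ?thesis
    using open_chart_preimage[OF c(1) open_ball] c r by (intro exI[of _ ?N']) auto
qed

end

section \<open>Primitives of a vector field\<close>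

lemma symmetric_of_axis:
  fixes D :: "real ^ 'm::finite \<Rightarrow> real ^ 'm"
  assumes "linear D" "\<And>i j. D (axis i 1) $ j = D (axis j 1) $ i"
  shows "D h \<bullet> k = D k \<bullet> h"
proof -
  have expand: "D h \<bullet> k = (\<Sum>i\<in>UNIV. \<Sum>j\<in>UNIV. h $ i * k $ j * D (axis i 1) $ j)" for h k
  proof -
    have "D h = D (\<Sum>i\<in>UNIV. h $ i *\<^sub>R axis i 1)"
      using basis_expansion[of h] by (simp add: scalar_mult_eq_scaleR)
    also have "\<dots> = (\<Sum>i\<in>UNIV. h $ i *\<^sub>R D (axis i 1))"
      using assms(1) by (simp add: linear_sum linear_scale)
    finally show ?thesis
      by (simp add: inner_sum_left inner_vec_def[of "D _"] sum_distrib_left mult_ac)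
  qed
  show ?thesis
    unfolding expand[of h k] expand[of k h]
    by (subst sum.swap) (simp add: assms(2) mult_ac)
qed

context riemannian
begin

text \<open>Definiteness, tested on the difference of the two vectors; this makes the description in
  \<open>gradient\<close> unique.\<close>

lemma tangent_eqI:
  assumes "w \<in> tangent_space A p" "w' \<in> tangent_space A p"
    "\<And>v. v \<in> tangent_space A p \<Longrightarrow> g p w v = g p w' v"
  shows "w = w'"
proof -
  obtain c where c: "c \<in> A" "p \<in> fst c" using chart_around by blast
  obtain a b where ab: "w = coord_combination A c p a" "w' = coord_combination A c p b"
    using assms(1,2) by (auto simp: tangent_space_eq[OF c])
  have "gram c p a (a - b) = gram c p b (a - b)"
    using assms(3)[OF in_tangent_space[OF c, of "a - b"]] by (simp add: gram_def ab)
  then have "gram c p (a - b) (a - b) = 0"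
    using linear_diff[OF gram_linear_left[OF c, of "a - b"], of a b] by simp
  then have "a - b = 0" by (rule gram_self_eq_0[OF c])
  then show ?thesis by (simp add: ab)
qed

text \<open>Differentiability is demanded separately: all tangent vectors vanish on a function that
  is not differentiable at \<open>p\<close>, so the equation alone would hold for such a function
  wherever \<open>V p\<close> is zero.\<close>

definition primitive_at :: "('a \<Rightarrow> 'a tangent) \<Rightarrow> ('a \<Rightarrow> real) \<Rightarrow> 'a \<Rightarrow> bool" where
  "primitive_at V u p \<longleftrightarrow>
     differentiable_at A u p \<and> (\<forall>v\<in>tangent_space A p. differential u p v = g p (V p) v)"

text \<open>One direction needs uniqueness of the representing vector. The other needs its
  existence, since otherwise the value of the description \<open>gradient\<close> would carry no
  information.\<close>

lemma gradient_eq_iff: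
  assumes V: "V p \<in> tangent_space A p" and u: "differentiable_at A u p"
  shows "gradient A g u p = V p \<longleftrightarrow> primitive_at V u p"
proof
  assume "primitive_at V u p"
  then show "gradient A g u p = V p"
    unfolding gradient_def primitive_at_def using V by (intro the_equality) (auto intro: tangent_eqI)
next
  obtain c where c: "c \<in> A" "p \<in> fst c" using chart_around by blast
  obtain D where D: "((u \<circ> chart_inv c) has_derivative D) (at (snd c p))"
    using u differentiable_at_iff[OF c] by (auto simp: differentiable_def)
  obtain a where a: "\<And>b. gram c p a b = (\<Sum>i\<in>Basis. D i *\<^sub>R i) \<bullet> b"
    using gram_riesz[OF c] by blast
  have D_inner: "(\<Sum>i\<in>Basis. D i *\<^sub>R i) \<bullet> b = D b" for b
  proof -
    have "D (\<Sum>i\<in>Basis. (b \<bullet> i) *\<^sub>R i) = (\<Sum>i\<in>Basis. (b \<bullet> i) * D i)"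
      using has_derivative_linear[OF D] by (simp add: linear_sum linear_scale)
    then have "D b = (\<Sum>i\<in>Basis. (b \<bullet> i) * D i)" by (simp only: euclidean_representation)
    then show ?thesis by (simp add: inner_sum_left inner_sum_right inner_commute[of _ b] mult.commute)
  qed
  let ?w = "coord_combination A c p a"
  have w: "?w \<in> tangent_space A p \<and> (\<forall>v\<in>tangent_space A p. differential u p v = g p ?w v)"
    using a D_inner coord_combination_apply[OF c D]
    by (auto simp: tangent_space_eq[OF c] differential_def gram_def)
  then have "gradient A g u p = ?w"
    unfolding gradient_def by (intro the_equality) (auto intro: tangent_eqI)
  moreover assume "gradient A g u p = V p"
  ultimately show "primitive_at V u p" using w u by (simp add: primitive_at_def)
qed

text \<open>The 1-form dual to \<open>V\<close>, packed into one vector-valued map on coordinate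
  space, in the shape required by the Poincare lemma and by the symmetry lemma.\<close>

definition lowered_coords :: "('a \<Rightarrow> 'a tangent) \<Rightarrow> ('a, 'm) chart \<Rightarrow> real ^ 'm \<Rightarrow> real ^ 'm" where
  "lowered_coords V c y = (\<chi> j. lowered A g V c j (chart_inv c y))"

lemma metric_eq_lowered:
  assumes c: "c \<in> A" "p \<in> fst c" and V: "V p \<in> tangent_space A p"
  shows "g p (V p) (coord_combination A c p h) = lowered_coords V c (snd c p) \<bullet> h"
proof -
  let ?a = "components A c p (V p)"
  have "gram c p ?a (axis j 1) = lowered A g V c j p" for j
    using gram_sum_right[OF c, of "axis j 1" ?a] gram_commute[OF c, of ?a "axis j 1"]
    by (simp add: lowered_def metric_coeff_def gram_def coord_combination_axis mult.commute)
  then have "gram c p ?a h = lowered_coords V c (snd c p) \<bullet> h"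
    using gram_sum_right[OF c, of ?a h] c by (simp add: lowered_coords_def inner_vec_def mult.commute)
  then show ?thesis by (simp add: gram_def coord_combination_components[OF c V])
qed

text \<open>The passage from operators to Euclidean calculus: tangent vectors at \<open>p\<close>
  are exactly the combinations with arbitrary \<open>h\<close>, on which both sides are
  evaluated.\<close>

lemma primitive_at_iff:
  assumes c: "c \<in> A" "p \<in> fst c" and V: "V p \<in> tangent_space A p"
  shows "primitive_at V u p \<longleftrightarrow>
    ((u \<circ> chart_inv c) has_derivative (\<lambda>h. lowered_coords V c (snd c p) \<bullet> h)) (at (snd c p))"
    (is "_ \<longleftrightarrow> (_ has_derivative ?L) _")
proof
  assume u: "primitive_at V u p"
  then obtain D where D: "((u \<circ> chart_inv c) has_derivative D) (at (snd c p))"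
    using differentiable_at_iff[OF c] by (auto simp: differentiable_def primitive_at_def)
  have "D h = ?L h" for h
    using u coord_combination_apply[OF c D, of h] metric_eq_lowered[where V = V, OF c V, of h]
    by (auto simp: primitive_at_def differential_def tangent_space_eq[OF c])
  then have "D = ?L" ..
  with D show "((u \<circ> chart_inv c) has_derivative ?L) (at (snd c p))" by simp
next
  assume D: "((u \<circ> chart_inv c) has_derivative ?L) (at (snd c p))"
  then show "primitive_at V u p"
    using coord_combination_apply[OF c D] metric_eq_lowered[where V = V, OF c V] differentiable_at_iff[OF c]
    by (auto simp: primitive_at_def differential_def differentiable_def tangent_space_eq[OF c])
qed

lemma primitive_at_transfer:
  assumes u: "primitive_at V u p" and V: "V p \<in> tangent_space A p"
    and ev: "\<forall>\<^sub>F q in nhds p. w q - w p = u q - u p"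
  shows "primitive_at V w p"
proof -
  obtain c where c: "c \<in> A" "p \<in> fst c" using chart_around by blast
  obtain N where N: "open N" "p \<in> N" "\<And>q. q \<in> N \<Longrightarrow> w q - w p = u q - u p"
    using ev by (auto simp: eventually_nhds)
  have "((\<lambda>y. (u \<circ> chart_inv c) y + (w p - u p)) has_derivative (\<lambda>h. lowered_coords V c (snd c p) \<bullet> h)) (at (snd c p))"
    using has_derivative_add[OF u[unfolded primitive_at_iff[where V = V, OF c V]] has_derivative_const[of "w p - u p"]]
    by simp
  then have "((w \<circ> chart_inv c) has_derivative (\<lambda>h. lowered_coords V c (snd c p) \<bullet> h)) (at (snd c p))"
  proof (rule has_derivative_transform_within_open[OF _ chart_image_open[OF c(1) N(1)]])
    show "(u \<circ> chart_inv c) y + (w p - u p) = (w \<circ> chart_inv c) y" if "y \<in> snd c ` (fst c \<inter> N)" for y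
      using that N(3) c by fastforce
  qed (use c N in auto)
  then show ?thesis by (simp add: primitive_at_iff[where V = V, OF c V])
qed

text \<open>In a chart the difference has derivative 0 on a ball, which is convex. This supplies
  \<open>local_uniqueness\<close> for the continuation argument.\<close>

lemma primitives_differ_locally_constant:
  assumes N: "open N" "p \<in> N" and V: "\<And>q. q \<in> N \<Longrightarrow> V q \<in> tangent_space A q"
    and u: "\<And>q. q \<in> N \<Longrightarrow> primitive_at V u q" and w: "\<And>q. q \<in> N \<Longrightarrow> primitive_at V w q"
  shows "\<forall>\<^sub>F q in nhds p. u q - u p = w q - w p"
proof -
  obtain c where c: "c \<in> A" "p \<in> fst c" using chart_around by blast
  obtain r where r: "r > 0" "ball (snd c p) r \<subseteq> snd c ` (fst c \<inter> N)" using chart_ball[OF c N] .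
  let ?f = "\<lambda>y. (u \<circ> chart_inv c) y - (w \<circ> chart_inv c) y"
  have "(?f has_derivative (\<lambda>h. 0)) (at y within ball (snd c p) r)" if y: "y \<in> ball (snd c p) r" for y
  proof -
    obtain q where q: "q \<in> fst c" "q \<in> N" "y = snd c q" using r y by blast
    show ?thesis
      using has_derivative_diff[OF u[OF q(2), unfolded primitive_at_iff[where V = V, OF c(1) q(1) V[OF q(2)]]]
          w[OF q(2), unfolded primitive_at_iff[where V = V, OF c(1) q(1) V[OF q(2)]]]] q(3)
      by (auto intro: has_derivative_at_withinI)
  qed
  then obtain C where C: "\<And>y. y \<in> ball (snd c p) r \<Longrightarrow> ?f y = C"
    using has_derivative_zero_constant[OF convex_ball, of "snd c p" r ?f] by blast
  have "?f (snd c p) = C" using C[of "snd c p"] r by simp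
  then have "u p - w p = C" using c by simp
  moreover have "\<forall>\<^sub>F y in nhds (snd c p). y \<in> ball (snd c p) r"
    using r by (intro eventually_nhds_in_open) auto
  ultimately have "\<forall>\<^sub>F y in nhds (snd c p). u (chart_inv c y) - u p = w (chart_inv c y) - w p"
    using C by (force elim!: eventually_mono)
  then show ?thesis by (rule eventually_nhds_chart[OF c])
qed

end

section \<open>The equation for a continuously differentiable field on an open set\<close>

locale riemannian_vector_field = riemannian A g
  for A :: "('a::{t2_space, second_countable_topology}, 'm::finite) chart set" and g +
  fixes \<Omega> :: "'a set" and V :: "'a \<Rightarrow> 'a tangent"
  assumes open_\<Omega>: "open \<Omega>" and C1_field: "Ck_vector_field A 1 \<Omega> V"
begin

lemma V_tangent: "p \<in> \<Omega> \<Longrightarrow> V p \<in> tangent_space A p"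
  using C1_field by (simp add: Ck_vector_field_def)

abbreviation "chart_domain c \<equiv> snd c ` (fst c \<inter> \<Omega>)"

lemma open_chart_domain: "c \<in> A \<Longrightarrow> open (chart_domain c)"
  by (rule chart_image_open[OF _ open_\<Omega>])

lemma Ck_on_lowered_coords:
  assumes c: "c \<in> A" shows "Ck_on 1 (chart_domain c) (lowered_coords V c)"
  unfolding lowered_coords_def
proof (rule Ck_on_vec_lambda)
  show acc: "axis_accumulating (chart_domain c)" by (rule axis_accumulating_open[OF open_chart_domain[OF c]])
  fix j
  have "Ck_on 1 (chart_domain c) (\<lambda>y. \<Sum>k\<in>UNIV. (metric_coeff A g c j k \<circ> chart_inv c) y *\<^sub>R
     ((\<lambda>p. components A c p (V p) $ k) \<circ> chart_inv c) y)"
  proof (intro Ck_on_sum Ck_on_scaleR acc)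
    fix k
    have "Ck_on 1 (snd c ` fst c) (metric_coeff A g c j k \<circ> chart_inv c)"
      using riemannian c unfolding riemannian_manifold_def smooth_on_def by blast
    then show "Ck_on 1 (chart_domain c) (metric_coeff A g c j k \<circ> chart_inv c)"
      by (rule Ck_on_subset) (auto intro: acc)
    show "Ck_on 1 (chart_domain c) ((\<lambda>p. components A c p (V p) $ k) \<circ> chart_inv c)"
      using C1_field c unfolding Ck_vector_field_def by blast
  qed
  then show "Ck_on 1 (chart_domain c) (\<lambda>y. lowered A g V c j (chart_inv c y))"
    by (simp only: lowered_def o_def real_scaleR_def)
qed

text \<open>Regularity is gained for free: the derivative of a pointwise primitive is the 1-form,
  which is \<open>C1\<close>, so the primitive is \<open>C2\<close>.\<close>

lemma C2_solution_iff: "C2_solution A g \<Omega> V u \<longleftrightarrow> (\<forall>p\<in>\<Omega>. primitive_at V u p)"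
proof
  assume u: "C2_solution A g \<Omega> V u"
  show "\<forall>p\<in>\<Omega>. primitive_at V u p"
  proof
    fix p assume p: "p \<in> \<Omega>"
    obtain c where c: "c \<in> A" "p \<in> fst c" using chart_around by blast
    have "Ck_on (Suc 1) (chart_domain c) (u \<circ> chart_inv c)"
      using u c by (simp add: C2_solution_def Ck_function_def numeral_2_eq_2)
    moreover have "snd c p \<in> chart_domain c" using c p by blast
    ultimately have "(u \<circ> chart_inv c) differentiable (at (snd c p))"
      using at_within_open[OF _ open_chart_domain[OF c(1)]] Ck_on.simps(2) by metis
    then have "differentiable_at A u p" by (simp add: differentiable_at_iff[OF c])
    then show "primitive_at V u p"
      using gradient_eq_iff[where V = V, OF V_tangent[OF p]] u p by (auto simp: C2_solution_def)
  qed
next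
  assume u: "\<forall>p\<in>\<Omega>. primitive_at V u p"
  have "Ck_on 2 (chart_domain c) (u \<circ> chart_inv c)" if c: "c \<in> A" for c
  proof -
    have acc: "axis_accumulating (chart_domain c)" by (rule axis_accumulating_open[OF open_chart_domain[OF c]])
    have "Ck_on (Suc 1) (chart_domain c) (u \<circ> chart_inv c)"
    proof (rule Ck_on_SucI[OF acc])
      fix y assume "y \<in> chart_domain c"
      then obtain p where p: "p \<in> fst c" "p \<in> \<Omega>" "y = snd c p" by blast
      then show "((u \<circ> chart_inv c) has_derivative (\<lambda>h. lowered_coords V c y \<bullet> h)) (at y within chart_domain c)"
        using u primitive_at_iff[where V = V, OF c p(1) V_tangent[OF p(2)], where u = u] by (auto intro: has_derivative_at_withinI)
    next
      show "Ck_on 1 (chart_domain c) (\<lambda>y. lowered_coords V c y \<bullet> v)" for v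
        by (rule Ck_on_bounded_linear[OF acc bounded_linear_inner_left Ck_on_lowered_coords[OF c]])
    qed
    then show ?thesis by (simp add: numeral_2_eq_2)
  qed
  moreover have "gradient A g u p = V p" if "p \<in> \<Omega>" for p
    using gradient_eq_iff[where V = V, OF V_tangent[OF that]] u that by (auto simp: primitive_at_def)
  ultimately show "C2_solution A g \<Omega> V u" by (simp add: C2_solution_def Ck_function_def)
qed

lemma lowered_coords_has_derivative:
  assumes "c \<in> A" "p \<in> fst c" "p \<in> \<Omega>"
  shows "(lowered_coords V c has_derivative frechet_derivative (lowered_coords V c) (at (snd c p))) (at (snd c p))"
proof -
  have "snd c p \<in> chart_domain c" using assms by blast
  then have "lowered_coords V c differentiable (at (snd c p) within chart_domain c)"
    using Ck_on_lowered_coords[OF assms(1)] by (metis One_nat_def Ck_on.simps(2))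
  then show ?thesis
    using at_within_open[OF \<open>snd c p \<in> chart_domain c\<close> open_chart_domain[OF assms(1)]]
    by (simp add: frechet_derivative_works)
qed

lemma coord_partial_lowered:
  assumes "c \<in> A" "p \<in> fst c" "p \<in> \<Omega>"
  shows "coord_partial c i (lowered A g V c j) p =
    frechet_derivative (lowered_coords V c) (at (snd c p)) (axis i 1) $ j"
proof -
  have "((\<lambda>y. lowered_coords V c y $ j) has_derivative
      (\<lambda>h. frechet_derivative (lowered_coords V c) (at (snd c p)) h $ j)) (at (snd c p))"
    by (rule bounded_linear.has_derivative[OF bounded_linear_vec_nth lowered_coords_has_derivative[OF assms]])
  moreover have "(\<lambda>y. lowered_coords V c y $ j) = lowered A g V c j \<circ> chart_inv c"
    by (simp add: lowered_coords_def o_def)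
  ultimately show ?thesis unfolding coord_partial_def by (metis frechet_derivative_at)
qed

lemma solution_imp_integrable:
  assumes "C2_solution A g \<Omega> V u" shows "integrability_condition A g \<Omega> V"
  unfolding integrability_condition_def
proof (intro ballI allI)
  fix c p i j assume c: "c \<in> A" and "p \<in> fst c \<inter> \<Omega>"
  then have p: "p \<in> fst c" "p \<in> \<Omega>" by auto
  let ?D = "frechet_derivative (lowered_coords V c) (at (snd c p))"
  have "?D (axis i 1) \<bullet> axis j 1 = ?D (axis j 1) \<bullet> axis i 1"
  proof (rule gradient_derivative_symmetric[OF open_chart_domain[OF c] _ _ lowered_coords_has_derivative[OF c p]])
    show "((u \<circ> chart_inv c) has_derivative (\<lambda>h. lowered_coords V c y \<bullet> h)) (at y)" if "y \<in> chart_domain c" for y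
      using that assms primitive_at_iff[where V = V, OF c _ V_tangent, where u = u] by (auto simp: C2_solution_iff)
  qed (use p in auto)
  then show "coord_partial c i (lowered A g V c j) p = coord_partial c j (lowered A g V c i) p"
    by (simp add: coord_partial_lowered[OF c p] inner_axis)
qed

definition local_primitive :: "'a set \<Rightarrow> ('a \<Rightarrow> real) \<Rightarrow> bool" where
  "local_primitive U f \<longleftrightarrow> open U \<and> U \<subseteq> \<Omega> \<and> (\<forall>q\<in>U. primitive_at V f q)"

lemma local_primitive_exists:
  assumes ic: "integrability_condition A g \<Omega> V" and p: "p \<in> \<Omega>"
  shows "\<exists>U f. local_primitive U f \<and> p \<in> U"
proof -
  obtain c where c: "c \<in> A" "p \<in> fst c" using chart_around by blast
  obtain r where r: "r > 0" "ball (snd c p) r \<subseteq> chart_domain c" using chart_ball[OF c open_\<Omega> p] .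
  let ?B = "ball (snd c p) r"
  obtain f where f: "\<And>y. y \<in> ?B \<Longrightarrow> (f has_derivative (\<lambda>h. lowered_coords V c y \<bullet> h)) (at y)"
  proof (rule poincare_star_shaped[of ?B "snd c p" "lowered_coords V c"])
    show "Ck_on 1 ?B (lowered_coords V c)"
      by (rule Ck_on_subset[OF Ck_on_lowered_coords[OF c(1)] r(2)]) (simp add: axis_accumulating_open)
    fix z h k assume "z \<in> ?B"
    then obtain q where q: "q \<in> fst c" "q \<in> \<Omega>" "z = snd c q" using r by blast
    show "frechet_derivative (lowered_coords V c) (at z) h \<bullet> k = frechet_derivative (lowered_coords V c) (at z) k \<bullet> h"
      unfolding q(3)
    proof (rule symmetric_of_axis[OF has_derivative_linear[OF lowered_coords_has_derivative[OF c(1) q(1,2)]]])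
      show "frechet_derivative (lowered_coords V c) (at (snd c q)) (axis i 1) $ j =
          frechet_derivative (lowered_coords V c) (at (snd c q)) (axis j 1) $ i" for i j
        unfolding coord_partial_lowered[OF c(1) q(1,2), symmetric]
        using ic c(1) q(1,2) unfolding integrability_condition_def by blast
    qed
  qed (use r in auto)
  define U where "U = fst c \<inter> snd c -` ?B"
  \<comment> \<open>The ball consists of coordinates of points of \<Omega>, and the chart is
    injective on its domain.\<close>
  have U\<Omega>: "q \<in> \<Omega>" if "q \<in> U" for q
  proof -
    have "snd c q \<in> ?B" "q \<in> fst c" using that by (auto simp: U_def)
    then obtain q' where "q' \<in> fst c \<inter> \<Omega>" "snd c q = snd c q'" using r by blast
    then show ?thesis using chart_inv_chart[OF c(1)] \<open>q \<in> fst c\<close> by (metis IntD1 IntD2)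
  qed
  have "primitive_at V (f \<circ> snd c) q" if q: "q \<in> U" for q
  proof -
    have q': "q \<in> fst c" "snd c q \<in> ?B" using q by (auto simp: U_def)
    have "((f \<circ> snd c) \<circ> chart_inv c has_derivative (\<lambda>h. lowered_coords V c (snd c q) \<bullet> h)) (at (snd c q))"
      by (rule has_derivative_transform_within_open[OF f[OF q'(2)] open_ball q'(2)])
        (use r c in \<open>auto\<close>)
    then show ?thesis by (simp add: primitive_at_iff[where V = V, OF c(1) q'(1) V_tangent[OF U\<Omega>[OF q]]])
  qed
  moreover have "open U" "p \<in> U" using open_chart_preimage[OF c(1) open_ball] c r by (auto simp: U_def)
  ultimately show ?thesis using U\<Omega> by (auto simp: local_primitive_def)
qed

lemma integrable_imp_solution:
  assumes ic: "integrability_condition A g \<Omega> V" and sc: "simply_connected \<Omega>"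
  shows "\<exists>u. C2_solution A g \<Omega> V u"
proof -
  interpret local_primitives \<Omega> local_primitive
  proof
    show "local_primitive U f \<Longrightarrow> open U" for U f by (simp add: local_primitive_def)
    show "p \<in> \<Omega> \<Longrightarrow> \<exists>U f. local_primitive U f \<and> p \<in> U" for p by (rule local_primitive_exists[OF ic])
    show "\<forall>\<^sub>F q in nhds p. f q - f p = f' q - f' p"
      if "local_primitive U f" "local_primitive U' f'" "p \<in> U" "p \<in> U'" for U f U' f' p
      using that V_tangent unfolding local_primitive_def
      by (intro primitives_differ_locally_constant[of "U \<inter> U'"]) auto
  qed
  obtain u where u: "\<And>p U f. p \<in> \<Omega> \<Longrightarrow> local_primitive U f \<Longrightarrow> p \<in> U \<Longrightarrow> \<forall>\<^sub>F q in nhds p. u q - u p = f q - f p"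
    by (rule global_primitive_exists[OF sc open_\<Omega> path_connected_neighbourhood]) (use that in blast)+
  have "primitive_at V u p" if p: "p \<in> \<Omega>" for p
  proof -
    obtain U f where U: "local_primitive U f" "p \<in> U" using local_primitive_exists[OF ic p] by blast
    then have "primitive_at V f p" by (simp add: local_primitive_def)
    then show ?thesis using primitive_at_transfer[where V = V, OF _ V_tangent[OF p] u[OF p U]] by blast
  qed
  then show ?thesis by (auto simp: C2_solution_iff)
qed

lemma line_integral:
  assumes u: "C2_solution A g \<Omega> V u" and \<gamma>: "curve_joining A \<Omega> x y \<gamma>"
  shows "(line_integrand A g V \<gamma> has_integral (u y - u x)) {0..1}"
proof -
  have s: "smooth_curve A \<gamma>" using \<gamma> by (simp add: curve_joining_def)
  have "((u \<circ> \<gamma>) has_vector_derivative line_integrand A g V \<gamma> t) (at t within {0..1})" if t: "t \<in> {0..1}" for t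
  proof -
    have "\<gamma> t \<in> \<Omega>" using \<gamma> t by (auto simp: curve_joining_def path_image_def)
    then have "primitive_at V u (\<gamma> t)" using u by (simp add: C2_solution_iff)
    then have "differentiable_at A u (\<gamma> t)" "velocity A \<gamma> t u = line_integrand A g V \<gamma> t"
      using velocity_eq(1)[OF s t] by (auto simp: primitive_at_def differential_def line_integrand_def)
    then show ?thesis using velocity_eq(2)[OF s t] by metis
  qed
  from fundamental_theorem_of_calculus[OF _ this]
  show ?thesis using \<gamma> by (simp add: curve_joining_def pathstart_def pathfinish_def)
qed

end

text \<open>Three clauses render the representation formula. Joining curves exist, so the other two
  are not vacuous; one arbitrary curve per point already makes the formula define a solution; every
  solution satisfies the formula for all curves, which contains independence of the curve.\<close>

theorem theorem2p1:
  fixes A :: "('a::{t2_space, second_countable_topology}, 'm::finite) chart set"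
    and g :: "'a metric_tensor"
    and \<Omega> :: "'a set"
    and V :: "'a \<Rightarrow> 'a tangent"
  assumes "riemannian_manifold A g"
    and "open \<Omega>"
    and "simply_connected \<Omega>"
    and "Ck_vector_field A 1 \<Omega> V"
  shows "((\<exists>u. C2_solution A g \<Omega> V u) \<longleftrightarrow> integrability_condition A g \<Omega> V) \<and>
    (\<forall>x0\<in>\<Omega>. integrability_condition A g \<Omega> V \<longrightarrow>
       (\<forall>x\<in>\<Omega>. \<exists>\<gamma>. curve_joining A \<Omega> x0 x \<gamma>) \<and>
       (\<forall>c0 u. (\<forall>x\<in>\<Omega>. \<exists>\<gamma>. curve_joining A \<Omega> x0 x \<gamma> \<and>
                   u x = c0 + integral {0..1} (line_integrand A g V \<gamma>))
          \<longrightarrow> C2_solution A g \<Omega> V u \<and> u x0 = c0) \<and>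
       (\<forall>u. C2_solution A g \<Omega> V u \<longrightarrow>
          (\<forall>x\<in>\<Omega>. \<forall>\<gamma>. curve_joining A \<Omega> x0 x \<gamma> \<longrightarrow>
             line_integrand A g V \<gamma> integrable_on {0..1} \<and>
             u x = u x0 + integral {0..1} (line_integrand A g V \<gamma>))))"
proof -
  interpret riemannian_vector_field A g \<Omega> V
    using assms by unfold_locales (auto simp: riemannian_manifold_def)
  have line: "line_integrand A g V \<gamma> integrable_on {0..1}"
    "u x = u x0 + integral {0..1} (line_integrand A g V \<gamma>)"
    if "C2_solution A g \<Omega> V u" "curve_joining A \<Omega> x0 x \<gamma>" for u x0 x \<gamma>
    using line_integral[OF that] by (auto simp: integral_unique has_integral_integrable)
  have conn: "connected \<Omega>"
    by (intro path_connected_imp_connected simply_connected_imp_path_connected_topological assms)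
  have "C2_solution A g \<Omega> V u \<and> u x0 = c0"
    if x0: "x0 \<in> \<Omega>" and ic: "integrability_condition A g \<Omega> V"
      and u: "\<forall>x\<in>\<Omega>. \<exists>\<gamma>. curve_joining A \<Omega> x0 x \<gamma> \<and> u x = c0 + integral {0..1} (line_integrand A g V \<gamma>)"
    for x0 c0 u
  proof -
    obtain w where w: "C2_solution A g \<Omega> V w" using integrable_imp_solution[OF ic assms(3)] by blast
    \<comment> \<open>The integrals are evaluated through the known solution \<open>w\<close>, so
      \<open>u\<close> differs from \<open>w\<close> by a constant on \<Omega>, whichever curves
      were chosen.\<close>
    have uw: "u x = c0 + (w x - w x0)" if "x \<in> \<Omega>" for x
      using u line(2)[OF w] that by fastforce
    have "primitive_at V u p" if p: "p \<in> \<Omega>" for p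
    proof (rule primitive_at_transfer)
      show "primitive_at V w p" using w p by (simp add: C2_solution_iff)
      \<comment> \<open>Nothing is known about \<open>u\<close> off \<Omega>, so the comparison with
        \<open>w\<close> is made near \<open>p\<close> inside the open set.\<close>
      have "\<forall>\<^sub>F q in nhds p. q \<in> \<Omega>" using open_\<Omega> p by (rule eventually_nhds_in_open)
      then show "\<forall>\<^sub>F q in nhds p. u q - u p = w q - w p"
        by eventually_elim (use uw p in simp)
    qed (rule V_tangent[OF p])
    then show ?thesis using uw[OF x0] by (simp add: C2_solution_iff)
  qed
  then show ?thesis
    using solution_imp_integrable integrable_imp_solution[OF _ assms(3)] line
      curve_joining_exists[OF assms(2) conn]
    by blast
qed

end
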